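(* Let $n \geq 4$ be an integer. The branch locus ${\mathcal B}_{0,[n+1]} \subset {\mathcal M}_{0,[n+1]}$ is connected if either (i) $n \geq 4$ is even, or (ii) $n \geq 6$ is divisible by $3$. Otherwise, ${\mathcal B}_{0,[n+1]}$ has exactly two connected components.
   Context: Let $n\ge 4$. ${\mathcal M}_{0,[n+1]}$ is the moduli space of isomorphism classes of $(n+1)$-marked spheres, i.e. of sets of $n+1$ pairwise distinct unordered points of the Riemann sphere $\widehat{\mathbb C}$ up to Möbius transformations. It is modelled as follows. Let $$\Omega_n=\{(z_1,\ldots,z_{n-2})\in{\mathbb C}^{n-2} : z_j\neq 0,1,\; z_i\neq z_j \text{ for } i\neq j\}.$$ A point $\lambda=(\lambda_1,\ldots,\lambda_{n-2})\in\Omega_n$ represents the class, modulo ${\rm PSL}_2({\mathbb C})$, of the ordered tuple $(p_1,\ldots,p_{n+1})=(\infty,0,1,\lambda_1,\ldots,\lambda_{n-2})$ of pairwise distinct points of $\widehat{\mathbb C}$. The symmetric group ${\mathfrak S}_{n+1}$ acts on $\Omega_n$ by permuting the entries of these tuples: $\sigma$ sends $\lambda$ to $(M(p_{\sigma^{-1}(4)}),\ldots,M(p_{\sigma^{-1}(n+1)}))$, where $M$ is the unique Möbius transformation with $M(p_{\sigma^{-1}(1)})=\infty$, $M(p_{\sigma^{-1}(2)})=0$, $M(p_{\sigma^{-1}(3)})=1$. For $n\ge4$ this action is faithful and its image is denoted by ${\mathbb G}_n\cong{\mathfrak S}_{n+1}$. Then ${\mathcal M}_{0,[n+1]}=\Omega_n/{\mathbb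 G}_n$ with the quotient topology. The branch locus ${\mathcal B}_{0,[n+1]}$ is the image in $\Omega_n/{\mathbb G}_n$ of the points of $\Omega_n$ with non-trivial ${\mathbb G}_n$-stabilizer; equivalently, it is the set of classes of those $\lambda$ for which the set $\{\infty,0,1,\lambda_1,\ldots,\lambda_{n-2}\}$ is invariant under some non-identity Möbius transformation. It carries the subspace topology. *)

theory Defs
  imports
    "HOL-Analysis.Analysis"
    "HOL-Algebra.Sym_Groups"
    "HOL-Algebra.Group_Action"
begin

text \<open>The Riemann sphere is the type \<^typ>\<open>complex option\<close>, with \<^const>\<open>None\<close> as the point at infinity
  (as in \<^const>\<open>Alexandroff_compactification\<close>).\<close>

definition sphere_moebius ::
  "complex \<Rightarrow> complex \<Rightarrow> complex \<Rightarrow> complex \<Rightarrow> complex option \<Rightarrow> complex option" where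
  "sphere_moebius a b c d p =
     (case p of
        None \<Rightarrow> if c = 0 then None else Some (a / c)
      | Some z \<Rightarrow> if c * z + d = 0 then None else Some (moebius a b c d z))"

definition moebius_transformations :: "(complex option \<Rightarrow> complex option) set" where
  "moebius_transformations = {sphere_moebius a b c d | a b c d. a * d - b * c \<noteq> 0}"

definition normalizing_moebius ::
  "complex option \<Rightarrow> complex option \<Rightarrow> complex option \<Rightarrow> complex option \<Rightarrow> complex option" where
  "normalizing_moebius p q r =
     (THE M. M \<in> moebius_transformations \<and> M p = None \<and> M q = Some 0 \<and> M r = Some 1)"

text \<open>Points of \<open>\<complex>\<^sup>n\<^sup>-\<^sup>2\<close> are the functions in \<open>{1..n - 2} \<rightarrow>\<^sub>E UNIV\<close>, i.e. they are
  \<^const>\<open>undefined\<close> outside the index set.\<close>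

definition Omega :: "nat \<Rightarrow> (nat \<Rightarrow> complex) set" where
  "Omega n =
     {z \<in> {1..n - 2} \<rightarrow>\<^sub>E UNIV.
        (\<forall>j\<in>{1..n - 2}. z j \<noteq> 0 \<and> z j \<noteq> 1) \<and>
        (\<forall>i\<in>{1..n - 2}. \<forall>j\<in>{1..n - 2}. i \<noteq> j \<longrightarrow> z i \<noteq> z j)}"

definition Omega_topology :: "nat \<Rightarrow> (nat \<Rightarrow> complex) topology" where
  "Omega_topology n = subtopology (product_topology (\<lambda>_. euclidean) {1..n - 2}) (Omega n)"

text \<open>The tuple \<open>(p\<^sub>1, \<dots>, p\<^bsub>n+1\<^esub>) = (\<infinity>, 0, 1, \<lambda>\<^sub>1, \<dots>, \<lambda>\<^bsub>n-2\<^esub>)\<close>; only the values at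
  \<open>i \<in> {1..n + 1}\<close> are meaningful.\<close>

definition marked_points :: "(nat \<Rightarrow> complex) \<Rightarrow> nat \<Rightarrow> complex option" where
  "marked_points l i =
     (if i = 1 then None
      else if i = 2 then Some 0
      else if i = 3 then Some 1
      else Some (l (i - 3)))"

text \<open>On \<^term>\<open>Omega n\<close> the argument of \<^const>\<open>the\<close> below is never infinity, since the
  normalizing Moebius transformation is injective and has its pole at another point of the tuple.\<close>

definition permute_action :: "nat \<Rightarrow> (nat \<Rightarrow> nat) \<Rightarrow> (nat \<Rightarrow> complex) \<Rightarrow> (nat \<Rightarrow> complex)" where
  "permute_action n \<sigma> =
     (\<lambda>l\<in>Omega n. \<lambda>j\<in>{1..n - 2}.
        let p = (\<lambda>i. marked_points l (inv_into UNIV \<sigma> i))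
        in the (normalizing_moebius (p 1) (p 2) (p 3) (p (j + 3))))"

definition moduli_group :: "nat \<Rightarrow> ((nat \<Rightarrow> complex) \<Rightarrow> (nat \<Rightarrow> complex)) monoid" where
  "moduli_group n =
     (BijGroup (Omega n)) \<lparr>carrier := permute_action n ` carrier (sym_group (n + 1))\<rparr>"

definition quotient_topology :: "'a topology \<Rightarrow> ('a \<Rightarrow> 'b) \<Rightarrow> 'b topology" where
  "quotient_topology X f =
     topology (\<lambda>U. U \<subseteq> f ` topspace X \<and> openin X {x \<in> topspace X. f x \<in> U})"

text \<open>The group \<^term>\<open>moduli_group n\<close> consists of maps, so it acts through \<^const>\<open>id\<close>.
  The points of the moduli space are its orbits.\<close>

definition moduli_class :: "nat \<Rightarrow> (nat \<Rightarrow> complex) \<Rightarrow> (nat \<Rightarrow> complex) set" where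
  "moduli_class n l = orbit (moduli_group n) id l"

definition moduli_space :: "nat \<Rightarrow> (nat \<Rightarrow> complex) set topology" where
  "moduli_space n = quotient_topology (Omega_topology n) (moduli_class n)"

definition branch_locus :: "nat \<Rightarrow> (nat \<Rightarrow> complex) set set" where
  "branch_locus n =
     moduli_class n `
       {l \<in> Omega n. stabilizer (moduli_group n) id l \<noteq> {\<one>\<^bsub>moduli_group n\<^esub>}}"

lemma openin_quotient_topology:
  "openin (quotient_topology X f) U \<longleftrightarrow>
     U \<subseteq> f ` topspace X \<and> openin X {x \<in> topspace X. f x \<in> U}"
proof -
  have "istopology (\<lambda>U. U \<subseteq> f ` topspace X \<and> openin X {x \<in> topspace X. f x \<in> U})"
    unfolding istopology_def
  proof (intro conjI allI impI)
    fix S T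
    assume S: "S \<subseteq> f ` topspace X \<and> openin X {x \<in> topspace X. f x \<in> S}"
      and T: "T \<subseteq> f ` topspace X \<and> openin X {x \<in> topspace X. f x \<in> T}"
    show "S \<inter> T \<subseteq> f ` topspace X" using S by blast
    have "{x \<in> topspace X. f x \<in> S \<inter> T} =
        {x \<in> topspace X. f x \<in> S} \<inter> {x \<in> topspace X. f x \<in> T}" by blast
    then show "openin X {x \<in> topspace X. f x \<in> S \<inter> T}"
      using S T by (simp add: openin_Int)
  next
    fix K
    assume K: "\<forall>S\<in>K. S \<subseteq> f ` topspace X \<and> openin X {x \<in> topspace X. f x \<in> S}"
    then show "\<Union>K \<subseteq> f ` topspace X" by blast
    have "{x \<in> topspace X. f x \<in> \<Union>K} = (\<Union>S\<in>K. {x \<in> topspace X. f x \<in> S})" by blast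
    then show "openin X {x \<in> topspace X. f x \<in> \<Union>K}" using K by auto
  qed
  then show ?thesis by (simp add: quotient_topology_def topology_inverse')
qed

lemma topspace_quotient_topology: "topspace (quotient_topology X f) = f ` topspace X"
proof
  show "topspace (quotient_topology X f) \<subseteq> f ` topspace X"
    using openin_quotient_topology[of X f "topspace (quotient_topology X f)"] by simp
  have "{x \<in> topspace X. f x \<in> f ` topspace X} = topspace X" by blast
  then show "f ` topspace X \<subseteq> topspace (quotient_topology X f)"
    by (intro openin_subset) (simp add: openin_quotient_topology)
qed

lemma quotient_map_quotient_topology: "quotient_map X (quotient_topology X f) f"
  by (auto simp: quotient_map_def topspace_quotient_topology openin_quotient_topology)

lemma topspace_Omega_topology: "topspace (Omega_topology n) = Omega n"
  by (auto simp: Omega_topology_def Omega_def)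

lemma topspace_moduli_space:
  "topspace (moduli_space n) = orbits (moduli_group n) (Omega n) id"
  by (auto simp: moduli_space_def topspace_quotient_topology topspace_Omega_topology
      moduli_class_def orbits_def)

lemma sphere_moebius_scale:
  "k \<noteq> 0 \<Longrightarrow> sphere_moebius (k * a) (k * b) (k * c) (k * d) = sphere_moebius a b c d"
proof
  fix p :: "complex option"
  assume k: "k \<noteq> 0"
  show "sphere_moebius (k * a) (k * b) (k * c) (k * d) p = sphere_moebius a b c d p"
  proof (cases p)
    case None
    then show ?thesis using k by (simp add: sphere_moebius_def)
  next
    case (Some z)
    have "k * c * z + k * d = k * (c * z + d)" "k * a * z + k * b = k * (a * z + b)"
      by (simp_all add: algebra_simps)
    then show ?thesis using k Some by (simp add: sphere_moebius_def moebius_def)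
  qed
qed

lemma ex1_normalizing_moebius:
  assumes "p \<noteq> q" "p \<noteq> r" "q \<noteq> r"
  shows "\<exists>!M. M \<in> moebius_transformations \<and> M p = None \<and> M q = Some 0 \<and> M r = Some 1"
proof -
  have crit: "\<exists>!M. M \<in> moebius_transformations \<and> M p = None \<and> M q = Some 0 \<and> M r = Some 1"
    if "a0 * d0 - b0 * c0 \<noteq> 0"
      and "sphere_moebius a0 b0 c0 d0 p = None"
      and "sphere_moebius a0 b0 c0 d0 q = Some 0"
      and "sphere_moebius a0 b0 c0 d0 r = Some 1"
      and uniq: "\<And>a b c d. a * d - b * c \<noteq> 0 \<Longrightarrow> sphere_moebius a b c d p = None \<Longrightarrow>
        sphere_moebius a b c d q = Some 0 \<Longrightarrow> sphere_moebius a b c d r = Some 1 \<Longrightarrow>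
        \<exists>k. k \<noteq> 0 \<and> a = k * a0 \<and> b = k * b0 \<and> c = k * c0 \<and> d = k * d0"
    for a0 b0 c0 d0
  proof (rule ex1I[of _ "sphere_moebius a0 b0 c0 d0"])
    show "sphere_moebius a0 b0 c0 d0 \<in> moebius_transformations \<and>
        sphere_moebius a0 b0 c0 d0 p = None \<and>
        sphere_moebius a0 b0 c0 d0 q = Some 0 \<and> sphere_moebius a0 b0 c0 d0 r = Some 1"
      using that unfolding moebius_transformations_def by blast
  next
    fix M
    assume M: "M \<in> moebius_transformations \<and> M p = None \<and> M q = Some 0 \<and> M r = Some 1"
    then obtain a b c d where abcd: "M = sphere_moebius a b c d" "a * d - b * c \<noteq> 0"
      unfolding moebius_transformations_def by blast
    with M uniq[of a d b c] obtain k where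
      "k \<noteq> 0" "a = k * a0" "b = k * b0" "c = k * c0" "d = k * d0" by auto
    then show "M = sphere_moebius a0 b0 c0 d0"
      by (simp only: abcd(1) sphere_moebius_scale not_False_eq_True)
  qed
  consider (p) y z where "p = None" "q = Some y" "r = Some z"
    | (q) x z where "p = Some x" "q = None" "r = Some z"
    | (r) x y where "p = Some x" "q = Some y" "r = None"
    | (fin) x y z where "p = Some x" "q = Some y" "r = Some z"
    using assms by (cases p; cases q; cases r) auto
  then show ?thesis
  proof cases
    case p
    show ?thesis
    proof (rule crit[of 1 "z - y" "- y" 0])
      fix a b c d
      assume "a * d - b * c \<noteq> 0" "sphere_moebius a b c d p = None"
        "sphere_moebius a b c d q = Some 0" "sphere_moebius a b c d r = Some 1"
      then have "c = 0" "a \<noteq> 0" "d \<noteq> 0" "a * y + b = 0" "a * z + b = d"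
        using p by (auto simp: sphere_moebius_def moebius_def split: if_splits)
      moreover from this have "b = a * (- y)"
        by (simp_all add: eq_neg_iff_add_eq_0 add.commute)
      moreover from calculation have "d = a * (z - y)"
        by (simp add: right_diff_distrib)
      ultimately show "\<exists>k. k \<noteq> 0 \<and> a = k * 1 \<and> b = k * (- y) \<and> c = k * 0 \<and> d = k * (z - y)"
        by (intro exI[of _ a]) simp
    qed (use p assms in \<open>auto simp: sphere_moebius_def moebius_def\<close>)
  next
    case q
    show ?thesis
    proof (rule crit[of 0 "- x" "z - x" 1])
      fix a b c d
      assume "a * d - b * c \<noteq> 0" "sphere_moebius a b c d p = None"
        "sphere_moebius a b c d q = Some 0" "sphere_moebius a b c d r = Some 1"
      then have "c \<noteq> 0" "a = 0" "c * x + d = 0" "b = c * z + d"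
        using q by (auto simp: sphere_moebius_def moebius_def split: if_splits)
      moreover from this have "d = c * (- x)" by (simp add: eq_neg_iff_add_eq_0 add.commute)
      ultimately show "\<exists>k. k \<noteq> 0 \<and> a = k * 0 \<and> b = k * (z - x) \<and> c = k * 1 \<and> d = k * (- x)"
        by (intro exI[of _ c]) (simp add: algebra_simps)
    qed (use q assms in \<open>auto simp: sphere_moebius_def moebius_def\<close>)
  next
    case r
    show ?thesis
    proof (rule crit[of 1 "- x" "- y" 1])
      fix a b c d
      assume "a * d - b * c \<noteq> 0" "sphere_moebius a b c d p = None"
        "sphere_moebius a b c d q = Some 0" "sphere_moebius a b c d r = Some 1"
      then have "c \<noteq> 0" "a = c" "c * x + d = 0" "a * y + b = 0"
        using r by (auto simp: sphere_moebius_def moebius_def split: if_splits)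
      moreover from this have "d = c * (- x)" "b = c * (- y)"
        by (simp_all add: eq_neg_iff_add_eq_0 add.commute)
      ultimately show "\<exists>k. k \<noteq> 0 \<and> a = k * 1 \<and> b = k * (- y) \<and> c = k * 1 \<and> d = k * (- x)"
        by (intro exI[of _ c]) simp
    qed (use r assms in \<open>auto simp: sphere_moebius_def moebius_def\<close>)
  next
    case fin
    then have ne: "x \<noteq> y" "x \<noteq> z" "y \<noteq> z" using assms by auto
    have det: "(z - x) * (- x * (z - y)) - (- y * (z - x)) * (z - y) = (z - x) * (z - y) * (y - x)"
      by (simp add: algebra_simps)
    show ?thesis
    proof (rule crit[of "z - x" "- x * (z - y)" "- y * (z - x)" "z - y"])
      fix a b c d
      assume *: "a * d - b * c \<noteq> 0" "sphere_moebius a b c d p = None"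
        "sphere_moebius a b c d q = Some 0" "sphere_moebius a b c d r = Some 1"
      then have eqs: "c * x + d = 0" "a * y + b = 0" "a * z + b = c * z + d"
        using fin by (auto simp: sphere_moebius_def moebius_def split: if_splits)
      then have d: "d = - c * x" and b: "b = - a * y"
        by (simp_all add: eq_neg_iff_add_eq_0 add.commute)
      then have ac: "a * (z - y) = c * (z - x)" using eqs(3) by (simp add: algebra_simps)
      have "c \<noteq> 0" using *(1) d b ac ne by auto
      moreover have a: "a = c / (z - y) * (z - x)" using ac ne by (simp add: divide_simps)
      moreover have "b = c / (z - y) * (- y * (z - x))" by (simp add: b a)
      moreover have "c = c / (z - y) * (z - y)" using ne by simp
      moreover have "d = c / (z - y) * (- x * (z - y))" using ne by (simp add: d)
      ultimately show "\<exists>k. k \<noteq> 0 \<and> a = k * (z - x) \<and> b = k * (- y * (z - x)) \<and>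
          c = k * (z - y) \<and> d = k * (- x * (z - y))"
        using ne by (intro exI[of _ "c / (z - y)"] conjI) simp_all
    next
      show "(z - x) * (- x * (z - y)) - (- y * (z - x)) * (z - y) \<noteq> 0"
        using det ne by simp
      have x: "(z - y) * x + (- x * (z - y)) = 0" by (simp add: algebra_simps)
      show "sphere_moebius (z - x) (- y * (z - x)) (z - y) (- x * (z - y)) p = None"
        using fin x by (simp add: sphere_moebius_def)
      have y: "(z - y) * y + (- x * (z - y)) = (z - y) * (y - x)"
        "(z - x) * y + (- y * (z - x)) = 0" by (simp_all add: algebra_simps)
      show "sphere_moebius (z - x) (- y * (z - x)) (z - y) (- x * (z - y)) q = Some 0"
        unfolding sphere_moebius_def moebius_def fin option.case y using ne by simp
      have z: "(z - y) * z + (- x * (z - y)) = (z - y) * (z - x)"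
        "(z - x) * z + (- y * (z - x)) = (z - y) * (z - x)" by (simp_all add: algebra_simps)
      show "sphere_moebius (z - x) (- y * (z - x)) (z - y) (- x * (z - y)) r = Some 1"
        unfolding sphere_moebius_def moebius_def fin option.case z using ne by simp
    qed
  qed
qed

end

theory Submission
  imports Defs "HOL-Computational_Algebra.Fundamental_Theorem_Algebra"
begin

text \<open>A set \<open>S\<close> of \<open>n + 1\<close> points of the sphere represents a branch point iff some Moebius transformation
  \<open>M \<noteq> id\<close> preserves it.  As \<open>S\<close> is finite, \<open>M\<close> has finite order and is conjugate to a rotation about
  \<open>0\<close> and \<open>\<infinity>\<close> (\<open>finite_order_conj_rotation\<close>), and \<open>S\<close> becomes a union of fibres of \<open>z \<mapsto> z\<^sup>d\<close>
  together with \<open>r \<in> {0, 1, 2}\<close> poles (\<open>symmetric_set_normal_form\<close>).  Sorting the symmetries by the number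
  \<open>r\<close> of their fixed points in \<open>S\<close> writes the branch locus as a union of three strata
  (\<open>branch_locus_eq\<close>).

  Each stratum is connected (\<open>connectedin_symmetric_stratum\<close>).  Two configurations with the same \<open>d\<close> and
  \<open>r\<close> are joined by straight interpolation along a bijection that commutes with the rotations: the
  collisions occur for finitely many complex parameters only, and the complement of a finite set in the
  plane is connected.  The regular \<open>(n + 1 - r)\<close>-gon with \<open>r\<close> poles has rotations of all orders \<open>d\<close> that
  occur, and so joins the pieces belonging to the different \<open>d\<close>.

  It remains to see which strata meet.  The half turn \<open>z \<mapsto> 1/z\<close> preserves the polygons with \<open>0\<close> or \<open>2\<close>
  poles.  For even \<open>n\<close> it fixes exactly one of the points, so these polygons also lie in the stratum
  \<open>r = 1\<close> and all three strata are joined.  For odd \<open>n\<close> it shows that the strata \<open>r = 0\<close> and \<open>r = 2\<close> meet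
  (\<open>polygon_class_in_other_stratum\<close>).  If moreover \<open>3\<close> divides \<open>n\<close>, then there is a configuration with
  tetrahedral symmetry in which a rotation of order three has one fixed point, while a half turn has
  none or two (\<open>strata_meet\<close>).  If \<open>n\<close> is prime to \<open>6\<close>, then the stratum \<open>r = 1\<close> is disjoint from the
  others (\<open>strata_disjoint\<close>): a rotation with a single fixed point in \<open>S\<close> has order at least five, and
  counting the fixed points of the finite symmetry group of \<open>S\<close> shows that its two fixed points are fixed
  by the whole group.  Finally all strata are closed, since they are given by polynomial equations
  (\<open>closedin_symmetric_stratum\<close>), so in this case the two disjoint connected pieces are the connected
  components.\<close>


section \<open>The Moebius group\<close>

abbreviation Moeb :: "(complex option \<Rightarrow> complex option) set" where
  "Moeb \<equiv> moebius_transformations"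

text \<open>The point with homogeneous coordinates \<open>(x : y)\<close>.  On such coordinates a Moebius transformation acts
  linearly, which avoids case distinctions on the point at infinity.\<close>

definition hpoint :: "complex \<Rightarrow> complex \<Rightarrow> complex option" where
  "hpoint x y = (if y = 0 then None else Some (x / y))"

lemma hpoint_cases:
  obtains x y where "p = hpoint x y" "x \<noteq> 0 \<or> y \<noteq> 0"
proof (cases p)
  case None
  then show ?thesis using that[of 1 0] by (simp add: hpoint_def)
next
  case (Some z)
  then show ?thesis using that[of z 1] by (simp add: hpoint_def)
qed

lemma hpoint_eq_iff:
  assumes "x \<noteq> 0 \<or> y \<noteq> 0" "x' \<noteq> 0 \<or> y' \<noteq> 0"
  shows "hpoint x y = hpoint x' y' \<longleftrightarrow> x * y' = x' * y"
  using assms by (auto simp: hpoint_def field_simps)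

lemma sphere_moebius_hpoint:
  assumes "a * d - b * c \<noteq> 0" "x \<noteq> 0 \<or> y \<noteq> 0"
  shows "sphere_moebius a b c d (hpoint x y) = hpoint (a * x + b * y) (c * x + d * y)"
proof (cases "y = 0")
  case True
  then show ?thesis using assms by (auto simp: sphere_moebius_def hpoint_def)
next
  case False
  have "c * (x / y) + d = (c * x + d * y) / y" "a * (x / y) + b = (a * x + b * y) / y"
    using False by (simp_all add: field_simps)
  then show ?thesis
    using False by (simp add: sphere_moebius_def hpoint_def moebius_def)
qed

lemma regular_matrix_kernel:
  fixes a :: complex
  assumes "a * d - b * c \<noteq> 0" "x \<noteq> 0 \<or> y \<noteq> 0"
  shows "a * x + b * y \<noteq> 0 \<or> c * x + d * y \<noteq> 0"
proof (rule ccontr)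
  assume "\<not> ?thesis"
  then have z: "a * x + b * y = 0" "c * x + d * y = 0" by auto
  have "(a * d - b * c) * x = d * (a * x + b * y) - b * (c * x + d * y)"
    "(a * d - b * c) * y = a * (c * x + d * y) - c * (a * x + b * y)"
    by (simp_all add: algebra_simps)
  then show False using z assms by auto
qed

lemma MoebI: "a * d - b * c \<noteq> 0 \<Longrightarrow> sphere_moebius a b c d \<in> Moeb"
  unfolding moebius_transformations_def by blast

lemma MoebE:
  assumes "M \<in> Moeb"
  obtains a b c d where "a * d - b * c \<noteq> 0" "M = sphere_moebius a b c d"
  using assms unfolding moebius_transformations_def by blast

lemma sphere_moebius_comp:
  assumes "a * d - b * c \<noteq> 0" "a' * d' - b' * c' \<noteq> 0"
  shows "sphere_moebius a b c d \<circ> sphere_moebius a' b' c' d' =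
    sphere_moebius (a * a' + b * c') (a * b' + b * d') (c * a' + d * c') (c * b' + d * d')"
    (is "_ = sphere_moebius ?A ?B ?C ?D")
    and "(a * a' + b * c') * (c * b' + d * d') - (a * b' + b * d') * (c * a' + d * c') \<noteq> 0"
proof -
  have "?A * ?D - ?B * ?C = (a * d - b * c) * (a' * d' - b' * c')"
    by (simp add: algebra_simps)
  then show det: "?A * ?D - ?B * ?C \<noteq> 0" using assms by simp
  show "sphere_moebius a b c d \<circ> sphere_moebius a' b' c' d' = sphere_moebius ?A ?B ?C ?D"
  proof
    fix p
    obtain x y where p: "p = hpoint x y" "x \<noteq> 0 \<or> y \<noteq> 0" by (rule hpoint_cases)
    show "(sphere_moebius a b c d \<circ> sphere_moebius a' b' c' d') p = sphere_moebius ?A ?B ?C ?D p"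
      using regular_matrix_kernel[OF assms(2) p(2)] det assms p
      by (simp add: sphere_moebius_hpoint algebra_simps)
  qed
qed

lemma sphere_moebius_one: "sphere_moebius 1 0 0 1 = id"
  by (auto simp: sphere_moebius_def moebius_def split: option.splits)

lemma Moeb_id [simp, intro]: "id \<in> Moeb"
  using MoebI[of 1 1 0 0] by (simp add: sphere_moebius_one)

lemma Moeb_comp [intro]: "M \<in> Moeb \<Longrightarrow> N \<in> Moeb \<Longrightarrow> M \<circ> N \<in> Moeb"
  by (elim MoebE) (simp only: sphere_moebius_comp(1) MoebI sphere_moebius_comp(2) not_False_eq_True)

lemma Moeb_funpow: "M \<in> Moeb \<Longrightarrow> M ^^ k \<in> Moeb"
  by (induction k) auto

lemma sphere_moebius_scalar: "a \<noteq> 0 \<Longrightarrow> sphere_moebius a 0 0 a = id"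
  using sphere_moebius_scale[of a 1 0 0 1] by (simp add: sphere_moebius_one)

lemma Moeb_inverse:
  assumes "M \<in> Moeb"
  obtains N where "N \<in> Moeb" "N \<circ> M = id" "M \<circ> N = id"
proof -
  obtain a b c d where M: "a * d - b * c \<noteq> 0" "M = sphere_moebius a b c d"
    using assms by (rule MoebE)
  define D where "D = a * d - b * c"
  have det: "d * a - (- b) * (- c) \<noteq> 0" using M by (simp add: algebra_simps)
  have "sphere_moebius d (- b) (- c) a \<circ> M = sphere_moebius D 0 0 D"
    unfolding M(2) sphere_moebius_comp(1)[OF det M(1)] by (simp add: D_def algebra_simps)
  moreover have "M \<circ> sphere_moebius d (- b) (- c) a = sphere_moebius D 0 0 D"
    unfolding M(2) sphere_moebius_comp(1)[OF M(1) det] by (simp add: D_def algebra_simps)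
  ultimately show ?thesis
    using that[OF MoebI[OF det]] M(1) by (simp add: D_def sphere_moebius_scalar)
qed

lemma bij_Moeb: "M \<in> Moeb \<Longrightarrow> bij M"
  using Moeb_inverse o_bij by metis

lemma inj_Moeb: "M \<in> Moeb \<Longrightarrow> inj_on M A"
  using bij_Moeb[of M] by (auto simp: bij_def inj_def inj_on_def)

lemma Moeb_eq_iff: "M \<in> Moeb \<Longrightarrow> M x = M y \<longleftrightarrow> x = y"
  using bij_Moeb[of M] by (simp add: bij_def inj_eq)

lemma inv_Moeb: "M \<in> Moeb \<Longrightarrow> inv_into UNIV M \<in> Moeb"
  by (metis Moeb_inverse inv_unique_comp)

lemma inv_Moeb_f [simp]: "M \<in> Moeb \<Longrightarrow> inv_into UNIV M (M x) = x"
  and Moeb_f_inv [simp]: "M \<in> Moeb \<Longrightarrow> M (inv_into UNIV M x) = x"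
  by (simp_all add: bij_Moeb bij_inv_eq_iff bij_is_inj inv_f_f surj_f_inv_f bij_is_surj)

lemma Moeb_cancel: "T \<in> Moeb \<Longrightarrow> T \<circ> M = T \<circ> N \<Longrightarrow> M = N"
  by (metis bij_Moeb bij_is_inj fun.inj_map inj_def)

lemma card_Moeb_image: "M \<in> Moeb \<Longrightarrow> card (M ` S) = card S"
  by (simp add: card_image inj_Moeb)

lemma Moeb_inv_image: "M \<in> Moeb \<Longrightarrow> inv_into UNIV M ` M ` S = S"
  by (simp add: image_image)

lemma Moeb_normalize:
  assumes "p \<noteq> q" "p \<noteq> r" "q \<noteq> r"
  obtains M where "M \<in> Moeb" "M p = None" "M q = Some 0" "M r = Some 1"
  using ex1_normalizing_moebius[OF assms] by blast

lemma Moeb_eqI: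
  assumes "M \<in> Moeb" "N \<in> Moeb" "p \<noteq> q" "p \<noteq> r" "q \<noteq> r" "M p = N p" "M q = N q" "M r = N r"
  shows "M = N"
proof -
  have ne: "M p \<noteq> M q" "M p \<noteq> M r" "M q \<noteq> M r"
    using assms(3-5) inj_Moeb[OF assms(1), of UNIV] by (auto simp: inj_eq)
  obtain T where T: "T \<in> Moeb" "T (M p) = None" "T (M q) = Some 0" "T (M r) = Some 1"
    using Moeb_normalize[OF ne] by blast
  have "T \<circ> M = T \<circ> N"
    using ex1_normalizing_moebius[OF assms(3-5)] T assms(1,2,6-8)
    by (metis Moeb_comp comp_apply)
  then show ?thesis
    by (rule Moeb_cancel[OF T(1)])
qed

lemma obtain_three:
  assumes "card S \<ge> 3"
  obtains p q r where "p \<in> S" "q \<in> S" "r \<in> S" "p \<noteq> q" "p \<noteq> r" "q \<noteq> r"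
proof -
  obtain T where "T \<subseteq> S" "card T = 3" using assms obtain_subset_with_card_n by metis
  then show ?thesis using that by (metis card_3_iff insert_subset)
qed

lemma Moeb_eqI_on:
  assumes "M \<in> Moeb" "N \<in> Moeb" "card S \<ge> 3" "\<And>x. x \<in> S \<Longrightarrow> M x = N x"
  shows "M = N"
  using assms(3) by (rule obtain_three) (use assms in \<open>auto intro: Moeb_eqI\<close>)

text \<open>Three values determine a Moebius transformation, so restriction to \<open>S\<close> embeds these transformations
  into the finitely many functions from \<open>S\<close> to \<open>T\<close>.\<close>

lemma finite_Moeb_maps_to:
  assumes "finite S" "finite T" "card S \<ge> 3"
  shows "finite {M \<in> Moeb. M ` S \<subseteq> T}"
proof (rule inj_on_finite)
  show "finite (S \<rightarrow>\<^sub>E T)" using assms by (intro finite_PiE) auto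
  show "(\<lambda>M. restrict M S) ` {M \<in> Moeb. M ` S \<subseteq> T} \<subseteq> S \<rightarrow>\<^sub>E T" by auto
  show "inj_on (\<lambda>M. restrict M S) {M \<in> Moeb. M ` S \<subseteq> T}"
    by (intro inj_onI Moeb_eqI_on[OF _ _ assms(3)]) (auto dest: fun_cong split: if_splits simp: restrict_def)
qed

text \<open>All powers preserve \<open>S\<close>, and only finitely many transformations do, so two powers agree.\<close>

lemma Moeb_finite_order:
  assumes "M \<in> Moeb" "M ` S = S" "finite S" "card S \<ge> 3"
  obtains k where "k > 0" "M ^^ k = id"
proof -
  have "(M ^^ k) ` S = S" for k
    by (induction k) (simp_all only: funpow.simps image_comp[symmetric] assms(2) image_ident id_def)
  then have "range (\<lambda>k. M ^^ k) \<subseteq> {M \<in> Moeb. M ` S \<subseteq> S}"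
    using Moeb_funpow[OF assms(1)] by auto
  then have "finite (range (\<lambda>k. M ^^ k))"
    using finite_Moeb_maps_to[OF assms(3,3,4)] finite_subset by blast
  then have "\<not> inj (\<lambda>k. M ^^ k)" using finite_imageD infinite_UNIV_nat by blast
  then obtain i j where ij: "i < j" "M ^^ i = M ^^ j"
    unfolding inj_def by (metis linorder_neqE_nat)
  have "M ^^ i \<circ> M ^^ (j - i) = M ^^ j"
    using ij(1) by (metis funpow_add le_add_diff_inverse less_imp_le)
  then have "M ^^ i \<circ> M ^^ (j - i) = M ^^ i \<circ> id" using ij(2) by simp
  then have "M ^^ (j - i) = id"
    by (rule Moeb_cancel[OF Moeb_funpow[OF assms(1)]])
  then show ?thesis using that[of "j - i"] ij(1) by simp
qed

lemma Moeb_has_fixed_point: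
  assumes "M \<in> Moeb"
  obtains p where "M p = p"
proof -
  obtain a b c d where M: "a * d - b * c \<noteq> 0" "M = sphere_moebius a b c d"
    using assms by (rule MoebE)
  show ?thesis
  proof (cases "c = 0")
    case True
    then show ?thesis using that[of None] M by (simp add: sphere_moebius_def)
  next
    case False
    \<comment> \<open>a root of the fixed point equation \<open>c z\<^sup>2 + (d - a) z - b = 0\<close>\<close>
    define s where "s = csqrt ((a - d)\<^sup>2 + 4 * b * c)"
    define z where "z = (a - d + s) / (2 * c)"
    have s: "s\<^sup>2 = (a - d)\<^sup>2 + 4 * b * c" by (simp add: s_def)
    have "s = 2 * c * z - (a - d)" using False by (simp add: z_def)
    then have "(2 * c * z - (a - d))\<^sup>2 = (a - d)\<^sup>2 + 4 * b * c" using s by simp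
    then have "4 * c * (c * z\<^sup>2 + (d - a) * z - b) = 0"
      by (simp add: algebra_simps power2_eq_square)
    then have "c * z\<^sup>2 + (d - a) * z - b = 0" using False by simp
    then have fix_eq: "a * z + b = z * (c * z + d)"
      by (simp add: algebra_simps power2_eq_square)
    have "M (hpoint z 1) = hpoint (a * z + b) (c * z + d)"
      using sphere_moebius_hpoint[OF M(1), of z 1] M(2) by simp
    also have "\<dots> = hpoint z 1"
      using regular_matrix_kernel[OF M(1), of z 1] fix_eq by (subst hpoint_eq_iff) auto
    finally show ?thesis using that by blast
  qed
qed

abbreviation rot :: "complex \<Rightarrow> complex option \<Rightarrow> complex option" where
  "rot a \<equiv> map_option ((*) a)"

lemma rot_eq: "rot a = sphere_moebius a 0 0 1"
  by (auto simp: sphere_moebius_def moebius_def split: option.splits)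

lemma rot_Moeb: "a \<noteq> 0 \<Longrightarrow> rot a \<in> Moeb"
  unfolding rot_eq by (rule MoebI) simp

lemma rot_funpow: "rot a ^^ k = rot (a ^ k)"
  by (induction k) (auto simp: option.map_comp o_def mult.assoc option.map_ident)

lemma conj_funpow:
  assumes "N \<circ> M = R \<circ> N"
  shows "N \<circ> M ^^ k = R ^^ k \<circ> N"
proof
  fix x
  have "N (M y) = R (N y)" for y using assms by (simp add: fun_eq_iff)
  then show "(N \<circ> M ^^ k) x = (R ^^ k \<circ> N) x" by (induction k) simp_all
qed

text \<open>A fixed point is moved to \<open>\<infinity>\<close>; the affine map so obtained is no translation, as it has
  finite order, and so it has a second fixed point, which is moved to \<open>0\<close>.\<close>

lemma finite_order_conj_rotation:
  assumes M: "M \<in> Moeb" and k: "k > 0" "M ^^ k = id" and ne: "M \<noteq> id"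
  obtains N a where "N \<in> Moeb" "N \<circ> M = rot a \<circ> N" "a \<noteq> 1" "a ^ k = 1"
proof -
  obtain p where p: "M p = p" using M by (rule Moeb_has_fixed_point)
  \<comment> \<open>\<open>T\<close> moves \<open>p\<close> to \<open>\<infinity>\<close>, and \<open>M'\<close> is the resulting affine map\<close>
  obtain T where T: "T \<in> Moeb" "T p = None"
  proof (cases p)
    case None
    then show ?thesis using that[of id] by auto
  next
    case (Some z)
    then show ?thesis using that[OF MoebI[of 0 "- z" 1 1]] by (simp add: sphere_moebius_def)
  qed
  define M' where "M' = T \<circ> M \<circ> inv_into UNIV T"
  have M': "M' \<in> Moeb" unfolding M'_def by (intro Moeb_comp inv_Moeb M T)
  have TM: "T \<circ> M = M' \<circ> T" by (rule ext) (simp add: M'_def T)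
  have "inv_into UNIV T None = p" using T by (metis inv_Moeb_f)
  then have M'None: "M' None = None" by (simp add: M'_def T p)
  obtain a' b' c' d' where M'e: "a' * d' - b' * c' \<noteq> 0" "M' = sphere_moebius a' b' c' d'"
    using M' by (rule MoebE)
  have c': "c' = 0" using M'None M'e(2) by (auto simp: sphere_moebius_def split: if_splits)
  have d': "d' \<noteq> 0" and a': "a' \<noteq> 0" using M'e(1) c' by auto
  define a b where "a = a' / d'" and "b = b' / d'"
  have M's: "M' = map_option (\<lambda>z. a * z + b)"
    by (rule ext) (use c' d' in \<open>auto simp: M'e(2) a_def b_def sphere_moebius_def moebius_def
        add_divide_distrib split: option.splits\<close>)
  have M'k: "M' ^^ k = id"
  proof
    fix x
    have "(T \<circ> M ^^ k) (inv_into UNIV T x) = (M' ^^ k \<circ> T) (inv_into UNIV T x)"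
      by (simp only: conj_funpow[OF TM])
    then show "(M' ^^ k) x = id x" by (simp add: k T)
  qed
  have M'ne: "M' \<noteq> id"
  proof
    assume "M' = id"
    then have "T \<circ> M = T \<circ> id" using TM by simp
    then show False using ne Moeb_cancel[OF T(1)] by blast
  qed
  have a1: "a \<noteq> 1"
  proof
    assume a: "a = 1"
    have "(M' ^^ j) (Some 0) = Some (of_nat j * b)" for j
      by (induction j) (auto simp: M's a algebra_simps)
    then have "of_nat k * b = 0" using M'k by (metis id_apply option.inject)
    then have "b = 0" using k by simp
    then show False using M'ne M's a by (auto simp: option.map_ident)
  qed
  define f where "f = b / (1 - a)"
  have f: "a * f + b = f" using a1 by (simp add: f_def field_simps)
  define N where "N = sphere_moebius 1 (- f) 0 1 \<circ> T"
  have N: "N \<in> Moeb" unfolding N_def by (intro Moeb_comp T MoebI) simp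
  have "sphere_moebius 1 (- f) 0 1 (M' x) = rot a (sphere_moebius 1 (- f) 0 1 x)" for x
    using f by (auto simp: M's sphere_moebius_def moebius_def algebra_simps split: option.splits)
  then have NM: "N \<circ> M = rot a \<circ> N"
    using TM by (auto simp: N_def fun_eq_iff)
  have "rot (a ^ k) (N (inv_into UNIV N (Some 1))) = N (inv_into UNIV N (Some 1))"
    using fun_cong[OF conj_funpow[OF NM, of k], of "inv_into UNIV N (Some 1)"]
    by (simp add: k rot_funpow)
  then have "a ^ k = 1" using N by simp
  with N NM a1 that show ?thesis by blast
qed

section \<open>Sets with a rotational symmetry\<close>

text \<open>A finite set with a rotational symmetry of order \<open>d\<close> about \<open>0\<close> and \<open>\<infinity>\<close> is a union of fibres of
  \<open>z \<mapsto> z\<^sup>d\<close>, together with \<open>r\<close> of the two poles.  A single pole is always taken to be \<open>\<infinity>\<close>, since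
  \<open>z \<mapsto> 1/z\<close> exchanges the poles.\<close>

definition power_fibre :: "nat \<Rightarrow> complex set \<Rightarrow> complex set" where
  "power_fibre d Z = {z. z ^ d \<in> Z}"

definition poles :: "nat \<Rightarrow> complex option set" where
  "poles r = (if r = 0 then {} else if r = 1 then {None} else {None, Some 0})"

definition rotsym :: "nat \<Rightarrow> complex set \<Rightarrow> nat \<Rightarrow> complex option set" where
  "rotsym d Z r = Some ` power_fibre d Z \<union> poles r"

lemma zero_notin_power_fibre: "d > 0 \<Longrightarrow> 0 \<notin> Z \<Longrightarrow> 0 \<notin> power_fibre d Z"
  by (simp add: power_fibre_def power_0_left)

lemma finite_card_power_fibre:
  assumes "d > 0" "finite Z" "0 \<notin> Z"
  shows "finite (power_fibre d Z)" "card (power_fibre d Z) = d * card Z"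
proof -
  have U: "power_fibre d Z = (\<Union>c\<in>Z. {z. z ^ d = c})" by (auto simp: power_fibre_def)
  have c: "card {z::complex. z ^ d = c} = d" if "c \<in> Z" for c
    using that assms by (intro card_nth_roots) auto
  have fin: "finite {z::complex. z ^ d = c}" if "c \<in> Z" for c
    using c[OF that] assms(1) card_ge_0_finite by fastforce
  show "finite (power_fibre d Z)" unfolding U using assms fin by blast
  have "card (power_fibre d Z) = (\<Sum>c\<in>Z. card {z::complex. z ^ d = c})"
    unfolding U using assms fin by (intro card_UN_disjoint) auto
  then show "card (power_fibre d Z) = d * card Z" using c by simp
qed

lemma finite_poles [simp]: "finite (poles r)"
  and card_poles: "r \<le> 2 \<Longrightarrow> card (poles r) = r"
  by (auto simp: poles_def)

lemma finite_rotsym: "d > 0 \<Longrightarrow> finite Z \<Longrightarrow> 0 \<notin> Z \<Longrightarrow> finite (rotsym d Z r)"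
  by (simp add: rotsym_def finite_card_power_fibre)

lemma card_rotsym:
  assumes "d > 0" "finite Z" "0 \<notin> Z" "r \<le> 2"
  shows "card (rotsym d Z r) = d * card Z + r"
proof -
  have "Some ` power_fibre d Z \<inter> poles r = {}"
    using zero_notin_power_fibre[OF assms(1,3)] by (auto simp: poles_def split: if_splits)
  then show ?thesis
    unfolding rotsym_def using finite_card_power_fibre[OF assms(1-3)] assms(4)
    by (subst card_Un_disjoint) (auto simp: card_image card_poles)
qed

lemma power_fibre_roots_of_unity: "power_fibre d {z. z ^ k = 1} = {z. z ^ (d * k) = 1}"
  by (simp add: power_fibre_def power_mult)

lemma rot_rotsym:
  assumes "a ^ d = 1" "d > 0"
  shows "rot a ` rotsym d Z r = rotsym d Z r"
proof -
  have a: "a \<noteq> 0" using assms by (auto simp: power_0_left)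
  have sub: "rot a ` rotsym d Z r \<subseteq> rotsym d Z r" if "a ^ d = 1" for a
    using that by (auto simp: rotsym_def power_fibre_def poles_def power_mult_distrib)
  have inv: "rot (inverse a) ` rotsym d Z r \<subseteq> rotsym d Z r"
    using assms by (intro sub) (simp add: power_inverse)
  have "rotsym d Z r = rot a ` rot (inverse a) ` rotsym d Z r"
  proof -
    have "rot a (rot (inverse a) x) = x" for x using a by (cases x) auto
    then show ?thesis by (simp add: image_image)
  qed
  also have "\<dots> \<subseteq> rot a ` rotsym d Z r" using inv by blast
  finally show ?thesis using sub[OF assms(1)] by blast
qed

lemma rot_fixed: "a \<noteq> 1 \<Longrightarrow> rot a x = x \<longleftrightarrow> x = None \<or> x = Some 0"
  by (cases x) auto

lemma rot_fixed_rotsym: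
  assumes "a \<noteq> 1" "d > 0" "0 \<notin> Z"
  shows "{x \<in> rotsym d Z r. rot a x = x} = poles r"
  using zero_notin_power_fibre[OF assms(2,3)]
  by (auto simp: rot_fixed[OF assms(1)] rotsym_def poles_def split: if_splits)

lemma obtain_root_of_unity:
  assumes "d \<ge> 2"
  obtains a :: complex where "a \<noteq> 1" "a ^ d = 1"
proof -
  have "card {z::complex. z ^ d = 1} = d" using assms by (intro card_roots_unity_eq) auto
  then have "\<not> {z::complex. z ^ d = 1} \<subseteq> {1}"
    using assms card_mono[of "{1::complex}" "{z. z ^ d = 1}"] by auto
  then show ?thesis using that by blast
qed

text \<open>All \<open>d\<close>-th roots of unity are powers of \<open>a\<close> if \<open>d\<close> is the order of \<open>a\<close>, so invariance under \<open>a\<close>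
  entails invariance under all of them.\<close>

lemma rotation_invariant_eq_power_fibre:
  assumes "a ^ k = 1" "k > 0" "a \<noteq> 1" "finite A" "(\<lambda>z. a * z) ` A \<subseteq> A"
  obtains d where "d \<ge> 2" "A = power_fibre d ((\<lambda>z. z ^ d) ` A)"
proof -
  define d where "d = (LEAST d. d > 0 \<and> a ^ d = 1)"
  have d: "d > 0 \<and> a ^ d = 1" unfolding d_def by (rule LeastI[of _ k]) (use assms in auto)
  have least: "\<And>e. e > 0 \<Longrightarrow> a ^ e = 1 \<Longrightarrow> d \<le> e" unfolding d_def by (rule Least_le) auto
  have d2: "d \<ge> 2" using d assms(3) by (cases "d = 1") auto
  have a0: "a \<noteq> 0" using d by (auto simp: power_0_left)
  have ne: "a ^ i \<noteq> a ^ j" if "i < j" "j < d" for i j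
  proof
    assume "a ^ i = a ^ j"
    also have "a ^ j = a ^ i * a ^ (j - i)" using that by (simp flip: power_add)
    finally have "a ^ (j - i) = 1" using a0 by simp
    then show False using least[of "j - i"] that by simp
  qed
  have "inj_on (\<lambda>j. a ^ j) {..<d}"
    by (rule inj_onI) (metis lessThan_iff linorder_neqE_nat ne)
  then have "card ((\<lambda>j. a ^ j) ` {..<d}) = d" by (simp add: card_image)
  moreover have "(\<lambda>j. a ^ j) ` {..<d} \<subseteq> {z. z ^ d = 1}"
  proof -
    have "(a ^ j) ^ d = 1" for j using d by (metis mult.commute power_mult power_one)
    then show ?thesis by blast
  qed
  moreover have "card {z::complex. z ^ d = 1} = d" using d by (intro card_roots_unity_eq) auto
  moreover have "finite {z::complex. z ^ d = 1}" using d by (intro finite_roots_unity) auto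
  ultimately have roots: "(\<lambda>j. a ^ j) ` {..<d} = {z. z ^ d = 1}"
    by (simp add: card_subset_eq)
  have pow: "a ^ j * z \<in> A" if "z \<in> A" for z j
    using that assms(5) by (induction j) (auto simp: mult.assoc)
  have "A = power_fibre d ((\<lambda>z. z ^ d) ` A)"
  proof
    show "power_fibre d ((\<lambda>z. z ^ d) ` A) \<subseteq> A"
    proof
      fix z assume "z \<in> power_fibre d ((\<lambda>z. z ^ d) ` A)"
      then obtain w where w: "w \<in> A" "z ^ d = w ^ d" by (auto simp: power_fibre_def)
      show "z \<in> A"
      proof (cases "w = 0")
        case True
        then show ?thesis using w d by (simp add: power_0_left)
      next
        case False
        then have "(z / w) ^ d = 1" using w by (simp add: power_divide)
        then obtain j where "z / w = a ^ j" using roots by blast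
        then have "z = a ^ j * w" using False by (simp add: field_simps)
        then show ?thesis using pow w by simp
      qed
    qed
  qed (auto simp: power_fibre_def)
  with d2 that show ?thesis by blast
qed

text \<open>The symmetry has finite order, so it is conjugate to a rotation; its fixed points are then the poles.\<close>

lemma symmetric_set_normal_form:
  assumes M: "M \<in> Moeb" "M \<noteq> id" "M ` S = S" and S: "finite S" "card S \<ge> 3"
  obtains N d Z where "N \<in> Moeb" "d \<ge> 2" "finite Z" "0 \<notin> Z"
    "N ` S = rotsym d Z (card {x \<in> S. M x = x})" "card {x \<in> S. M x = x} \<le> 2"
proof -
  obtain k where k: "k > 0" "M ^^ k = id" using Moeb_finite_order[OF M(1,3) S] .
  obtain N a where N: "N \<in> Moeb" "N \<circ> M = rot a \<circ> N" and a: "a \<noteq> 1" "a ^ k = 1"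
    using finite_order_conj_rotation[OF M(1) k M(2)] .
  have NM: "N (M x) = rot a (N x)" for x using N(2) by (simp add: fun_eq_iff)
  define A where "A = {z. Some z \<in> N ` S}"
  have finA: "finite A"
    unfolding A_def using finite_vimageI[of "N ` S" Some] S(1) by (simp add: vimage_def)
  have "rot a ` N ` S = N ` S" using M(3) by (metis N(2) image_comp)
  then have "rot a (Some z) \<in> N ` S" if "Some z \<in> N ` S" for z using that by blast
  then have "(\<lambda>z. a * z) ` A \<subseteq> A" unfolding A_def by auto
  then obtain d where d: "d \<ge> 2" "A = power_fibre d ((\<lambda>z. z ^ d) ` A)"
    using rotation_invariant_eq_power_fibre[OF a(2) k(1) a(1) finA] by blast
  define Z where "Z = (\<lambda>z. z ^ d) ` (A - {0})"
  have Z: "finite Z" "0 \<notin> Z" using finA d by (auto simp: Z_def)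
  have pf: "power_fibre d Z = A - {0}"
  proof -
    have "power_fibre d Z = power_fibre d ((\<lambda>z. z ^ d) ` A) - {0}"
      using d(1) by (auto simp: power_fibre_def Z_def power_0_left)
    then show ?thesis using d(2) by simp
  qed
  have NS: "N ` S = Some ` power_fibre d Z \<union> (N ` S \<inter> {None, Some 0})"
  proof (intro equalityI subsetI)
    fix x assume "x \<in> N ` S"
    then show "x \<in> Some ` power_fibre d Z \<union> (N ` S \<inter> {None, Some 0})"
      unfolding pf by (cases x) (auto simp: A_def)
  qed (auto simp: pf A_def)
  have "M x = x \<longleftrightarrow> rot a (N x) = N x" for x using NM N(1) by (metis inv_Moeb_f)
  then have "N ` {x \<in> S. M x = x} = {y \<in> N ` S. rot a y = y}" by auto
  also have "\<dots> = N ` S \<inter> {None, Some 0}" unfolding rot_fixed[OF a(1)] by blast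
  finally have r: "card {x \<in> S. M x = x} = card (N ` S \<inter> {None, Some 0})"
    using card_Moeb_image[OF N(1), of "{x \<in> S. M x = x}"] by simp
  consider "None \<in> N ` S" "Some 0 \<in> N ` S" | "None \<in> N ` S" "Some 0 \<notin> N ` S"
    | "None \<notin> N ` S" "Some 0 \<notin> N ` S" | "None \<notin> N ` S" "Some 0 \<in> N ` S" by blast
  then show ?thesis
  proof cases
    case 1
    then have e: "N ` S \<inter> {None, Some 0} = {None, Some 0}" by auto
    show ?thesis using that[OF N(1) d(1) Z] NS unfolding r rotsym_def poles_def e by simp
  next
    case 2
    then have e: "N ` S \<inter> {None, Some 0} = {None}" by auto
    show ?thesis using that[OF N(1) d(1) Z] NS unfolding r rotsym_def poles_def e by simp
  next
    case 3
    then have e: "N ` S \<inter> {None, Some 0} = {}" by auto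
    show ?thesis using that[OF N(1) d(1) Z] NS unfolding r rotsym_def poles_def e by simp
  next
    case 4
    then have e: "N ` S \<inter> {None, Some 0} = {Some 0}" by auto
    \<comment> \<open>the only pole in the set is moved from \<open>0\<close> to \<open>\<infinity>\<close> by \<open>z \<mapsto> 1/z\<close>\<close>
    define J where "J = sphere_moebius 0 1 1 0"
    have J: "J \<in> Moeb" unfolding J_def by (rule MoebI) simp
    have Jv: "J None = Some 0" "J (Some 0) = None" "\<And>z. z \<noteq> 0 \<Longrightarrow> J (Some z) = Some (inverse z)"
      by (simp_all add: J_def sphere_moebius_def moebius_def field_simps)
    have z0: "z \<noteq> 0" if "z \<in> power_fibre d W" "0 \<notin> W" for z W
      using that d(1) zero_notin_power_fibre[of d W] by auto
    have iZ: "finite (inverse ` Z)" "0 \<notin> inverse ` Z" using Z by auto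
    have "J ` Some ` power_fibre d Z = Some ` inverse ` power_fibre d Z"
      unfolding image_image by (rule image_cong) (use Jv z0 Z in auto)
    also have "inverse ` power_fibre d Z = power_fibre d (inverse ` Z)"
    proof (intro equalityI subsetI)
      fix z assume "z \<in> power_fibre d (inverse ` Z)"
      then have "inverse z \<in> power_fibre d Z"
        by (auto simp: power_fibre_def power_inverse)
      then show "z \<in> inverse ` power_fibre d Z" by (metis image_eqI inverse_inverse_eq)
    qed (auto simp: power_fibre_def power_inverse)
    finally have JF: "J ` Some ` power_fibre d Z = Some ` power_fibre d (inverse ` Z)" .
    have "(J \<circ> N) ` S = J ` (N ` S)" by (rule image_comp[symmetric])
    also have "N ` S = Some ` power_fibre d Z \<union> {Some 0}" using NS unfolding e .
    finally have "(J \<circ> N) ` S = rotsym d (inverse ` Z) 1"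
      using JF by (simp add: image_Un Jv rotsym_def poles_def)
    then show ?thesis using that[OF Moeb_comp[OF J N(1)] d(1) iZ] unfolding r e by simp
  qed
qed

section \<open>Points of the moduli space as classes of subsets of the sphere\<close>

text \<open>Up to Moebius transformations and permutations, a tuple only matters through the set of its entries.
  So a point of the moduli space is named by any set of \<open>n + 1\<close> points of the sphere, whether or not it
  contains \<open>\<infinity>\<close>, \<open>0\<close> and \<open>1\<close>, and the configurations below can be chosen in convenient position.\<close>

definition marked_set :: "nat \<Rightarrow> (nat \<Rightarrow> complex) \<Rightarrow> complex option set" where
  "marked_set n l = marked_points l ` {1..n + 1}"

definition sphere_class :: "nat \<Rightarrow> complex option set \<Rightarrow> (nat \<Rightarrow> complex) set" where
  "sphere_class n S = {l \<in> Omega n. \<exists>M\<in>Moeb. M ` S = marked_set n l}"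

lemma marked_points_simps [simp]:
  "marked_points l (Suc 0) = None" "marked_points l 2 = Some 0" "marked_points l 3 = Some 1"
  "j \<ge> 1 \<Longrightarrow> marked_points l (j + 3) = Some (l j)"
  by (auto simp: marked_points_def)

lemma inj_on_marked_points:
  assumes "l \<in> Omega n"
  shows "inj_on (marked_points l) {1..n + 1}"
proof (rule inj_onI)
  fix i j assume ij: "i \<in> {1..n + 1}" "j \<in> {1..n + 1}" "marked_points l i = marked_points l j"
  have ix: "k \<in> {1..n + 1} \<Longrightarrow> k > 3 \<Longrightarrow> k - 3 \<in> {1..n - 2}" for k by auto
  have l: "k \<in> {1..n + 1} \<Longrightarrow> k > 3 \<Longrightarrow> l (k - 3) \<noteq> 0 \<and> l (k - 3) \<noteq> 1" for k
    using assms ix[of k] unfolding Omega_def by blast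
  have l2: "i > 3 \<Longrightarrow> j > 3 \<Longrightarrow> i - 3 \<noteq> j - 3 \<Longrightarrow> l (i - 3) \<noteq> l (j - 3)"
    using assms ij(1,2) ix[of i] ix[of j] unfolding Omega_def by blast
  consider "i > 3" "j > 3" | "i \<in> {1,2,3}" "j > 3" | "i > 3" "j \<in> {1,2,3}" |
    "i \<in> {1,2,3}" "j \<in> {1,2,3}"
    using ij(1,2) by fastforce
  then show "i = j"
  proof cases
    case 1
    then have "i - 3 = j - 3" using ij(3) l2 by (auto simp: marked_points_def)
    then show ?thesis using 1 by simp
  next
    case 2
    then show ?thesis using ij(3) l[OF ij(2)] by (auto simp: marked_points_def split: if_splits)
  next
    case 3
    then show ?thesis using ij(3) l[OF ij(1)] by (auto simp: marked_points_def split: if_splits)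
  next
    case 4
    then show ?thesis using ij(3) by (auto simp: marked_points_def)
  qed
qed

lemma card_marked_set: "l \<in> Omega n \<Longrightarrow> card (marked_set n l) = n + 1"
  using card_image[OF inj_on_marked_points] by (simp add: marked_set_def)

lemma finite_marked_set: "finite (marked_set n l)"
  by (simp add: marked_set_def)

text \<open>The passage from tuples of distinct points of the sphere, normalized at the first three entries, to
  coordinates in \<^const>\<open>Omega\<close>.\<close>

lemma normalized_tuple:
  assumes n: "n \<ge> 2" and inj: "inj_on P {1..n + 1}"
    and P: "P 1 = None" "P 2 = Some 0" "P 3 = Some 1"
  defines "l \<equiv> \<lambda>j\<in>{1..n - 2}. the (P (j + 3))"
  shows "l \<in> Omega n" "\<And>i. i \<in> {1..n + 1} \<Longrightarrow> marked_points l i = P i"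
proof -
  have ne: "P i \<noteq> P j" if "i \<in> {1..n + 1}" "j \<in> {1..n + 1}" "i \<noteq> j" for i j
    using inj that by (auto dest: inj_onD)
  have Pj: "P (j + 3) = Some (l j)" if "j \<in> {1..n - 2}" for j
    using ne[of "j + 3" 1] that n P(1) by (auto simp: l_def)
  have "l j \<noteq> 0 \<and> l j \<noteq> 1" if "j \<in> {1..n - 2}" for j
  proof -
    have "P (j + 3) \<noteq> P 2" "P (j + 3) \<noteq> P 3" by (rule ne; use that n in auto)+
    then show ?thesis unfolding Pj[OF that] P by auto
  qed
  moreover have "l i \<noteq> l j" if "i \<in> {1..n - 2}" "j \<in> {1..n - 2}" "i \<noteq> j" for i j
  proof -
    have "P (i + 3) \<noteq> P (j + 3)" by (rule ne) (use that n in auto)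
    then show ?thesis unfolding Pj[OF that(1)] Pj[OF that(2)] by simp
  qed
  ultimately show "l \<in> Omega n" by (auto simp: Omega_def l_def)
  show "marked_points l i = P i" if "i \<in> {1..n + 1}" for i
  proof (cases "i \<le> 3")
    case True
    then have "i = 1 \<or> i = 2 \<or> i = 3" using that by auto
    then show ?thesis using P by (auto simp: marked_points_def)
  next
    case False
    then have "i - 3 \<in> {1..n - 2}" using that by auto
    from Pj[OF this] show ?thesis using False by (auto simp: marked_points_def)
  qed
qed

lemma normalizing_moebius_eq:
  assumes "M \<in> Moeb" "M p = None" "M q = Some 0" "M r = Some 1"
  shows "normalizing_moebius p q r = M"
proof -
  have "p \<noteq> q" "p \<noteq> r" "q \<noteq> r" using assms by auto
  from ex1_normalizing_moebius[OF this] show ?thesis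
    unfolding normalizing_moebius_def using assms by (intro the1_equality) auto
qed

lemma permute_action_eqI:
  assumes "n \<ge> 2" "l \<in> Omega n" "l' \<in> Omega n" "M \<in> Moeb"
    "\<And>i. i \<in> {1..n + 1} \<Longrightarrow> M (marked_points l (inv_into UNIV \<sigma> i)) = marked_points l' i"
  shows "permute_action n \<sigma> l = l'"
proof -
  let ?p = "\<lambda>i. marked_points l (inv_into UNIV \<sigma> i)"
  have M: "normalizing_moebius (?p 1) (?p 2) (?p 3) = M"
    using assms(5)[of 1] assms(5)[of 2] assms(5)[of 3] assms(1,4)
    by (intro normalizing_moebius_eq) auto
  have "permute_action n \<sigma> l = (\<lambda>j\<in>{1..n - 2}. the (M (?p (j + 3))))"
    using assms(2) M by (simp add: permute_action_def Let_def)
  also have "\<dots> = (\<lambda>j\<in>{1..n - 2}. l' j)"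
    using assms(5) by (intro restrict_ext) auto
  also have "\<dots> = l'"
    using assms(3) by (intro PiE_restrict[of _ _ "\<lambda>_. UNIV"]) (simp add: Omega_def)
  finally show ?thesis .
qed

lemma permute_actionE:
  assumes "n \<ge> 2" "l \<in> Omega n" "\<sigma> permutes {1..n + 1}"
  obtains M where "M \<in> Moeb" "permute_action n \<sigma> l \<in> Omega n"
    "\<And>i. i \<in> {1..n + 1} \<Longrightarrow>
      M (marked_points l (inv_into UNIV \<sigma> i)) = marked_points (permute_action n \<sigma> l) i"
proof -
  let ?p = "\<lambda>i. marked_points l (inv_into UNIV \<sigma> i)"
  have s: "inv_into UNIV \<sigma> permutes {1..n + 1}" using assms(3) by (rule permutes_inv)
  have "inj_on (marked_points l) (inv_into UNIV \<sigma> ` {1..n + 1})"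
    unfolding permutes_image[OF s] by (rule inj_on_marked_points[OF assms(2)])
  from comp_inj_on[OF permutes_inj_on[OF s] this]
  have inj: "inj_on ?p {1..n + 1}" by (simp only: o_def)
  have "?p 1 \<noteq> ?p 2" "?p 1 \<noteq> ?p 3" "?p 2 \<noteq> ?p 3"
    using assms(1) by (auto simp: inj_on_eq_iff[OF inj])
  then obtain M where M: "M \<in> Moeb" "M (?p 1) = None" "M (?p 2) = Some 0" "M (?p 3) = Some 1"
    using Moeb_normalize by blast
  have injP: "inj_on (\<lambda>i. M (?p i)) {1..n + 1}"
    using comp_inj_on[OF inj inj_Moeb[OF M(1)]] by (simp add: o_def)
  note N = normalized_tuple[OF assms(1) injP M(2-4)]
  have "permute_action n \<sigma> l = (\<lambda>j\<in>{1..n - 2}. the (M (?p (j + 3))))"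
    by (rule permute_action_eqI[OF assms(1,2) N(1) M(1)]) (rule N(2)[symmetric])
  then show ?thesis using that[OF M(1)] N by simp
qed

lemma sphere_class_representative:
  assumes "n \<ge> 2" "card S = n + 1"
  obtains l M where "l \<in> Omega n" "M \<in> Moeb" "M ` S = marked_set n l"
proof -
  have "finite S" using assms card_ge_0_finite by force
  then obtain f where f: "bij_betw f {1..n + 1} S"
    using ex_bij_betw_nat_finite_1 assms(2) by metis
  have inj: "inj_on f {1..n + 1}" using f by (rule bij_betw_imp_inj_on)
  have "f 1 \<noteq> f 2" "f 1 \<noteq> f 3" "f 2 \<noteq> f 3" using assms(1) by (auto simp: inj_on_eq_iff[OF inj])
  then obtain M where M: "M \<in> Moeb" "M (f 1) = None" "M (f 2) = Some 0" "M (f 3) = Some 1"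
    using Moeb_normalize by blast
  have injP: "inj_on (\<lambda>i. M (f i)) {1..n + 1}"
    using comp_inj_on[OF inj inj_Moeb[OF M(1)]] by (simp add: o_def)
  note N = normalized_tuple[OF assms(1) injP M(2-4)]
  have "M ` S = M ` f ` {1..n + 1}" using f by (simp add: bij_betw_def)
  also have "\<dots> = marked_set n (\<lambda>j\<in>{1..n - 2}. the (M (f (j + 3))))"
    unfolding marked_set_def image_image by (rule image_cong[OF refl]) (rule N(2)[symmetric])
  finally show ?thesis using that[OF N(1) M(1)] by simp
qed

lemma sphere_class_Moeb:
  assumes "M \<in> Moeb"
  shows "sphere_class n (M ` S) = sphere_class n S"
proof -
  have "(\<exists>N\<in>Moeb. N ` M ` S = T) \<longleftrightarrow> (\<exists>N\<in>Moeb. N ` S = T)" for T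
  proof
    assume "\<exists>N\<in>Moeb. N ` M ` S = T"
    then show "\<exists>N\<in>Moeb. N ` S = T" using assms by (metis Moeb_comp image_comp)
  next
    assume "\<exists>N\<in>Moeb. N ` S = T"
    then obtain N where N: "N \<in> Moeb" "N ` S = T" by blast
    then have "(N \<circ> inv_into UNIV M) ` M ` S = T"
      using Moeb_inv_image[OF assms, of S] unfolding image_comp[symmetric] by simp
    then show "\<exists>N\<in>Moeb. N ` M ` S = T" using Moeb_comp[OF N(1) inv_Moeb[OF assms]] by blast
  qed
  then show ?thesis by (simp add: sphere_class_def)
qed

lemma marked_set_in_class:
  assumes "l \<in> Omega n"
  shows "l \<in> sphere_class n (marked_set n l)"
proof -
  have "id ` marked_set n l = marked_set n l" by simp
  then show ?thesis unfolding sphere_class_def using assms Moeb_id by blast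
qed

lemma sphere_class_eqD:
  assumes "l \<in> Omega n" "sphere_class n (marked_set n l) = sphere_class n S"
  obtains M where "M \<in> Moeb" "M ` S = marked_set n l"
proof -
  have "l \<in> sphere_class n S" using marked_set_in_class[OF assms(1)] by (simp only: assms(2))
  then show ?thesis unfolding sphere_class_def using that by blast
qed

text \<open>The labels of the points are recovered from the sets: this is what relates symmetries of sets to the
  action of the symmetric group.\<close>

lemma Moeb_induces_permutation:
  assumes "l \<in> Omega n" "l' \<in> Omega n" "M \<in> Moeb" "M ` marked_set n l = marked_set n l'"
  obtains \<tau> where "\<tau> permutes {1..n + 1}"
    "\<And>i. i \<in> {1..n + 1} \<Longrightarrow> M (marked_points l (\<tau> i)) = marked_points l' i"
proof -
  let ?I = "{1..n + 1}"
  define \<tau> where "\<tau> i = (if i \<in> ?I then inv_into ?I (\<lambda>j. M (marked_points l j)) (marked_points l' i)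
    else i)" for i
  have inj: "inj_on (\<lambda>j. M (marked_points l j)) ?I"
    using comp_inj_on[OF inj_on_marked_points[OF assms(1)] inj_Moeb[OF assms(3)]]
    by (simp add: o_def)
  have im: "(\<lambda>j. M (marked_points l j)) ` ?I = marked_points l' ` ?I"
    using assms(4) by (simp add: marked_set_def image_image)
  have "bij_betw (inv_into ?I (\<lambda>j. M (marked_points l j)) \<circ> marked_points l') ?I ?I"
    using inj im inj_on_marked_points[OF assms(2)]
    by (metis bij_betw_def bij_betw_inv_into bij_betw_trans)
  then have "bij_betw \<tau> ?I ?I"
    by (rule bij_betw_cong[THEN iffD1, rotated]) (simp add: \<tau>_def)
  then have \<tau>: "\<tau> permutes ?I" by (rule bij_imp_permutes) (auto simp: \<tau>_def)
  have "M (marked_points l (\<tau> i)) = marked_points l' i" if "i \<in> ?I" for i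
    using that im f_inv_into_f[of "marked_points l' i" "\<lambda>j. M (marked_points l j)" ?I]
    by (auto simp: \<tau>_def)
  with \<tau> show ?thesis by (rule that)
qed

lemma carrier_moduli_group:
  "carrier (moduli_group n) = permute_action n ` {\<sigma>. \<sigma> permutes {1..n + 1}}"
  by (simp add: moduli_group_def sym_group_def)

lemma one_moduli_group: "\<one>\<^bsub>moduli_group n\<^esub> = (\<lambda>l\<in>Omega n. l)"
  by (simp add: moduli_group_def BijGroup_def)

lemma moduli_class_eq_sphere_class:
  assumes "n \<ge> 2" "l \<in> Omega n"
  shows "moduli_class n l = sphere_class n (marked_set n l)"
proof (intro equalityI subsetI)
  fix l' assume "l' \<in> moduli_class n l"
  then obtain \<sigma> where \<sigma>: "\<sigma> permutes {1..n + 1}" "l' = permute_action n \<sigma> l"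
    by (auto simp: moduli_class_def orbit_def carrier_moduli_group)
  obtain M where M: "M \<in> Moeb" "l' \<in> Omega n"
    "\<And>i. i \<in> {1..n + 1} \<Longrightarrow> M (marked_points l (inv_into UNIV \<sigma> i)) = marked_points l' i"
    using permute_actionE[OF assms \<sigma>(1)] \<sigma>(2) by blast
  have "M ` marked_set n l = M ` marked_points l ` inv_into UNIV \<sigma> ` {1..n + 1}"
    using permutes_image[OF permutes_inv[OF \<sigma>(1)]] by (simp only: marked_set_def)
  also have "\<dots> = marked_set n l'"
    unfolding marked_set_def image_image by (rule image_cong) (simp_all add: M(3))
  finally show "l' \<in> sphere_class n (marked_set n l)" using M by (auto simp: sphere_class_def)
next
  fix l' assume "l' \<in> sphere_class n (marked_set n l)"
  then obtain M where M: "M \<in> Moeb" "M ` marked_set n l = marked_set n l'" "l' \<in> Omega n"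
    by (auto simp: sphere_class_def)
  obtain \<tau> where \<tau>: "\<tau> permutes {1..n + 1}"
    "\<And>i. i \<in> {1..n + 1} \<Longrightarrow> M (marked_points l (\<tau> i)) = marked_points l' i"
    using Moeb_induces_permutation[OF assms(2) M(3,1,2)] by blast
  have "permute_action n (inv_into UNIV \<tau>) l = l'"
    by (rule permute_action_eqI[OF assms M(3,1)]) (simp add: permutes_inv_inv[OF \<tau>(1)] \<tau>(2))
  then show "l' \<in> moduli_class n l"
    using permutes_inv[OF \<tau>(1)] by (auto simp: moduli_class_def orbit_def carrier_moduli_group)
qed

section \<open>The branch locus\<close>

lemma finite_fixed_points:
  assumes "M \<in> Moeb" "M \<noteq> id"
  shows "finite {x. M x = x}" "card {x. M x = x} \<le> 2"
proof -
  have le: "card T < 3" if "T \<subseteq> {x. M x = x}" for T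
    using Moeb_eqI_on[OF assms(1) Moeb_id, of T] that assms(2) by (auto simp: not_le[symmetric])
  show "finite {x. M x = x}"
  proof (rule ccontr)
    assume "infinite {x. M x = x}"
    then obtain T where T: "T \<subseteq> {x. M x = x}" "card T = 3"
      using infinite_arbitrarily_large by blast
    show False using le[OF T(1)] T(2) by simp
  qed
  show "card {x. M x = x} \<le> 2" using le[of "{x. M x = x}"] by simp
qed

text \<open>Add a further point \<open>w\<close> to a set \<open>S\<close> of \<open>n \<ge> 4\<close> points.  A symmetry of the larger set maps at least three
  points of \<open>S\<close> into \<open>S\<close>, so it is one of finitely many transformations that do not depend on \<open>w\<close>.  As
  \<open>w\<close> is fixed by it or is the image of a point of \<open>S\<close> under it, all but finitely many \<open>w\<close> admit only
  the identity.\<close>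

lemma exists_asymmetric_point:
  assumes n: "n \<ge> 4"
  obtains l where "l \<in> Omega n" "\<And>M. M \<in> Moeb \<Longrightarrow> M ` marked_set n l = marked_set n l \<Longrightarrow> M = id"
proof -
  define S where "S = (\<lambda>k. Some (of_nat k :: complex)) ` {..<n}"
  have "inj_on (\<lambda>k. Some (of_nat k :: complex)) {..<n}" by (rule inj_onI) simp
  then have S: "finite S" "card S = n" by (simp_all add: S_def card_image)
  define F where "F = (\<Union>T\<in>{T. T \<subseteq> S \<and> card T \<ge> 3}. {M \<in> Moeb. M ` T \<subseteq> S})"
  have finF: "finite F" unfolding F_def
    using S(1) by (intro finite_UN_I finite_Moeb_maps_to) (auto intro: finite_subset)
  define bad where "bad = S \<union> (\<Union>M\<in>F - {id}. {x. M x = x}) \<union> (\<lambda>(M, u). M u) ` (F \<times> S)"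
  have "finite {x. M x = x}" if "M \<in> F - {id}" for M
    using that finite_fixed_points(1) unfolding F_def by blast
  then have "finite bad" unfolding bad_def using finF S(1)
    by (intro finite_UnI finite_UN_I finite_imageI finite_SigmaI finite_Diff)
  moreover have "infinite (UNIV :: complex option set)"
    using infinite_UNIV_char_0 by simp
  ultimately obtain w where w: "w \<notin> bad" using ex_new_if_finite by blast
  have wS: "w \<notin> S" using w unfolding bad_def by blast
  have asym: "M = id" if M: "M \<in> Moeb" "M ` insert w S = insert w S" for M
  proof (cases "M w = w")
    case True
    have "M ` S \<subseteq> S"
    proof
      fix y assume "y \<in> M ` S"
      then obtain x where x: "x \<in> S" "y = M x" by blast
      then have "y \<noteq> w" using True wS Moeb_eq_iff[OF M(1), of x w] by auto
      have "M x \<in> M ` insert w S" using x by simp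
      then have "y \<in> insert w S" unfolding M(2) using x by simp
      then show "y \<in> S" using \<open>y \<noteq> w\<close> by simp
    qed
    then have "M \<in> F" using M(1) S n unfolding F_def by auto
    then show ?thesis using w True unfolding bad_def by blast
  next
    case False
    have "w \<in> M ` insert w S" unfolding M(2) by simp
    then obtain u where u: "u \<in> insert w S" "M u = w" by (metis imageE)
    then have uS: "u \<in> S" using False by auto
    have "M ` (S - {u}) \<subseteq> S"
    proof
      fix y assume "y \<in> M ` (S - {u})"
      then obtain x where x: "x \<in> S" "x \<noteq> u" "y = M x" by blast
      then have "y \<noteq> w" using u Moeb_eq_iff[OF M(1), of x u] by auto
      have "M x \<in> M ` insert w S" using x by simp
      then have "y \<in> insert w S" unfolding M(2) using x by simp
      then show "y \<in> S" using \<open>y \<noteq> w\<close> by simp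
    qed
    moreover have "card (S - {u}) \<ge> 3" using S uS n by simp
    ultimately have "M \<in> F" using M(1) unfolding F_def by blast
    then have "(M, u) \<in> F \<times> S" using uS by simp
    then have "w \<in> (\<lambda>(M, u). M u) ` (F \<times> S)" using u(2) by (intro image_eqI[of _ _ "(M, u)"]) auto
    then have "w \<in> bad" unfolding bad_def by blast
    then show ?thesis using w by simp
  qed
  have "card (insert w S) = n + 1" using S wS by simp
  then obtain l N where l: "l \<in> Omega n" "N \<in> Moeb" "N ` insert w S = marked_set n l"
    using sphere_class_representative[of n "insert w S"] n by auto
  have "M = id" if M: "M \<in> Moeb" "M ` marked_set n l = marked_set n l" for M
  proof -
    have "(inv_into UNIV N \<circ> M \<circ> N) ` insert w S = inv_into UNIV N ` M ` N ` insert w S"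
      by (simp only: image_comp comp_assoc)
    also have "\<dots> = inv_into UNIV N ` N ` insert w S" by (simp only: l(3) M(2))
    also have "\<dots> = insert w S" by (rule Moeb_inv_image[OF l(2)])
    finally have "inv_into UNIV N \<circ> M \<circ> N = id"
      by (intro asym Moeb_comp inv_Moeb l M)
    then have "inv_into UNIV N (M (N (inv_into UNIV N x))) = inv_into UNIV N x" for x
      by (simp add: fun_eq_iff)
    then show "M = id" using Moeb_eq_iff[OF inv_Moeb[OF l(2)]] Moeb_f_inv[OF l(2)]
      by (simp add: fun_eq_iff)
  qed
  with l(1) show ?thesis by (rule that)
qed

lemma permute_action_id:
  assumes "n \<ge> 2"
  shows "permute_action n id = \<one>\<^bsub>moduli_group n\<^esub>"
proof
  fix l
  show "permute_action n id l = \<one>\<^bsub>moduli_group n\<^esub> l"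
  proof (cases "l \<in> Omega n")
    case True
    then show ?thesis
      using permute_action_eqI[OF assms True True Moeb_id, of id] by (simp add: one_moduli_group)
  qed (simp add: one_moduli_group permute_action_def)
qed

text \<open>The stabilizer consists of maps on \<^const>\<open>Omega\<close>, not of permutations, so a permutation that comes
  from a symmetry of one configuration must be shown to act non-trivially somewhere.  It does so at an
  asymmetric configuration; this is the faithfulness of the action.\<close>

lemma nontrivial_stabilizer_iff:
  assumes n: "n \<ge> 4" and l: "l \<in> Omega n"
  shows "stabilizer (moduli_group n) id l \<noteq> {\<one>\<^bsub>moduli_group n\<^esub>} \<longleftrightarrow>
    (\<exists>M\<in>Moeb. M \<noteq> id \<and> M ` marked_set n l = marked_set n l)"
proof -
  have n2: "n \<ge> 2" using n by simp
  let ?I = "{1..n + 1}"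
  have stab: "stabilizer (moduli_group n) id l =
      {permute_action n \<sigma> | \<sigma>. \<sigma> permutes ?I \<and> permute_action n \<sigma> l = l}"
    by (auto simp: stabilizer_def carrier_moduli_group)
  have "\<one>\<^bsub>moduli_group n\<^esub> \<in> stabilizer (moduli_group n) id l"
  proof -
    have "permute_action n id l = l"
      unfolding permute_action_id[OF n2] one_moduli_group using l by simp
    then show ?thesis
      unfolding stab permute_action_id[OF n2, symmetric] using permutes_id[of ?I] by blast
  qed
  then have ex: "stabilizer (moduli_group n) id l \<noteq> {\<one>\<^bsub>moduli_group n\<^esub>} \<longleftrightarrow>
    (\<exists>\<sigma>. \<sigma> permutes ?I \<and> permute_action n \<sigma> l = l \<and> permute_action n \<sigma> \<noteq> \<one>\<^bsub>moduli_group n\<^esub>)"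
    unfolding stab by blast
  show ?thesis unfolding ex
  proof
    assume "\<exists>\<sigma>. \<sigma> permutes ?I \<and> permute_action n \<sigma> l = l \<and> permute_action n \<sigma> \<noteq> \<one>\<^bsub>moduli_group n\<^esub>"
    then obtain \<sigma> where s: "\<sigma> permutes ?I" "permute_action n \<sigma> l = l"
      "permute_action n \<sigma> \<noteq> \<one>\<^bsub>moduli_group n\<^esub>" by blast
    obtain M where M: "M \<in> Moeb"
      "\<And>i. i \<in> ?I \<Longrightarrow> M (marked_points l (inv_into UNIV \<sigma> i)) = marked_points l i"
      using permute_actionE[OF n2 l s(1)] s(2) by metis
    have im: "inv_into UNIV \<sigma> ` ?I = ?I" by (rule permutes_image[OF permutes_inv[OF s(1)]])
    have "M ` marked_set n l = M ` marked_points l ` inv_into UNIV \<sigma> ` ?I"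
      unfolding im marked_set_def ..
    also have "\<dots> = marked_set n l"
      unfolding marked_set_def image_image by (rule image_cong[OF refl]) (rule M(2))
    finally have inv: "M ` marked_set n l = marked_set n l" .
    have "M \<noteq> id"
    proof
      assume "M = id"
      have "inv_into UNIV \<sigma> i = i" for i
      proof (cases "i \<in> ?I")
        case True
        then have "inv_into UNIV \<sigma> i \<in> ?I" using im by blast
        then show ?thesis
          using M(2)[OF True] True \<open>M = id\<close> inj_onD[OF inj_on_marked_points[OF l]] by simp
      next
        case False
        then show ?thesis using permutes_not_in[OF permutes_inv[OF s(1)]] by blast
      qed
      then have "\<sigma> = id" using permutes_inv_inv[OF s(1)] by (metis eq_id_iff inv_id)
      then show False using s(3) permute_action_id[OF n2] by simp
    qed
    with M(1) inv show "\<exists>M\<in>Moeb. M \<noteq> id \<and> M ` marked_set n l = marked_set n l" by blast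
  next
    assume "\<exists>M\<in>Moeb. M \<noteq> id \<and> M ` marked_set n l = marked_set n l"
    then obtain M where M: "M \<in> Moeb" "M \<noteq> id" "M ` marked_set n l = marked_set n l" by blast
    obtain \<tau> where \<tau>: "\<tau> permutes ?I"
      "\<And>i. i \<in> ?I \<Longrightarrow> M (marked_points l (\<tau> i)) = marked_points l i"
      using Moeb_induces_permutation[OF l l M(1,3)] by blast
    define \<sigma> where "\<sigma> = inv_into UNIV \<tau>"
    have s: "\<sigma> permutes ?I" "inv_into UNIV \<sigma> = \<tau>"
      using \<tau>(1) by (simp_all add: \<sigma>_def permutes_inv permutes_inv_inv)
    have fixl: "permute_action n \<sigma> l = l"
      by (rule permute_action_eqI[OF n2 l l M(1)]) (simp only: s(2) \<tau>(2))
    have "permute_action n \<sigma> \<noteq> \<one>\<^bsub>moduli_group n\<^esub>"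
    proof
      assume one: "permute_action n \<sigma> = \<one>\<^bsub>moduli_group n\<^esub>"
      obtain l0 where l0: "l0 \<in> Omega n"
        "\<And>M. M \<in> Moeb \<Longrightarrow> M ` marked_set n l0 = marked_set n l0 \<Longrightarrow> M = id"
        using exists_asymmetric_point[OF n] by blast
      have p0: "permute_action n \<sigma> l0 = l0" using l0(1) by (simp add: one one_moduli_group)
      obtain M0 where M0: "M0 \<in> Moeb"
        "\<And>i. i \<in> ?I \<Longrightarrow> M0 (marked_points l0 (\<tau> i)) = marked_points l0 i"
        using permute_actionE[OF n2 l0(1) s(1)] p0 s(2) by metis
      have im: "\<tau> ` ?I = ?I" by (rule permutes_image[OF \<tau>(1)])
      have "M0 ` marked_set n l0 = M0 ` marked_points l0 ` \<tau> ` ?I"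
        unfolding im marked_set_def ..
      also have "\<dots> = marked_set n l0"
        unfolding marked_set_def image_image by (rule image_cong[OF refl]) (rule M0(2))
      finally have "M0 = id" using l0(2) M0(1) by blast
      have \<tau>i: "\<tau> i = i" if "i \<in> ?I" for i
      proof -
        have "\<tau> i \<in> ?I" using im that by blast
        then show ?thesis
          using M0(2)[OF that] that \<open>M0 = id\<close> inj_onD[OF inj_on_marked_points[OF l0(1)]] by simp
      qed
      have "M x = id x" if "x \<in> marked_set n l" for x
      proof -
        from that obtain i where i: "i \<in> ?I" "x = marked_points l i" unfolding marked_set_def by blast
        then show ?thesis using \<tau>(2)[OF i(1)] \<tau>i[OF i(1)] by simp
      qed
      then have "M = id"
        using card_marked_set[OF l] n by (intro Moeb_eqI_on[OF M(1) Moeb_id, of "marked_set n l"]) auto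
      then show False using M(2) by simp
    qed
    with s(1) fixl show "\<exists>\<sigma>. \<sigma> permutes ?I \<and> permute_action n \<sigma> l = l \<and>
        permute_action n \<sigma> \<noteq> \<one>\<^bsub>moduli_group n\<^esub>" by blast
  qed
qed

text \<open>Strata may overlap, as a configuration can have several symmetries, with different numbers of fixed
  points among the marked points.  How the strata meet decides how many components there are.\<close>

definition symmetric_stratum :: "nat \<Rightarrow> nat \<Rightarrow> (nat \<Rightarrow> complex) set set" where
  "symmetric_stratum n r = {sphere_class n S | S M. card S = n + 1 \<and> M \<in> Moeb \<and> M \<noteq> id \<and>
     M ` S = S \<and> card {x \<in> S. M x = x} = r}"

lemma conjugate_symmetry:
  assumes "M \<in> Moeb" "M \<noteq> id" "M ` S = S" "N \<in> Moeb" "N ` S = T"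
  obtains M' where "M' \<in> Moeb" "M' \<noteq> id" "M' ` T = T"
    "card {x \<in> T. M' x = x} = card {x \<in> S. M x = x}"
proof -
  define M' where "M' = N \<circ> M \<circ> inv_into UNIV N"
  have M': "M' \<in> Moeb" unfolding M'_def by (intro Moeb_comp inv_Moeb assms)
  have conj: "M' (N x) = N (M x)" for x by (simp add: M'_def assms(4))
  have fix_iff: "M' (N x) = N x \<longleftrightarrow> M x = x" for x unfolding conj by (rule Moeb_eq_iff[OF assms(4)])
  have "M' \<noteq> id" using fix_iff assms(2) by (auto simp: fun_eq_iff)
  moreover have "M' ` T = T"
  proof -
    have "M' ` T = (\<lambda>x. M' (N x)) ` S" by (simp only: assms(5)[symmetric] image_image)
    also have "\<dots> = N ` M ` S" by (simp only: conj image_image)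
    finally show ?thesis by (simp only: assms(3,5))
  qed
  moreover have "{x \<in> T. M' x = x} = N ` {x \<in> S. M x = x}" using fix_iff assms(5) by auto
  then have "card {x \<in> T. M' x = x} = card {x \<in> S. M x = x}"
    by (simp add: card_Moeb_image[OF assms(4)])
  ultimately show ?thesis using that M' by blast
qed

lemma mem_symmetric_stratum_iff:
  assumes n: "n \<ge> 2" and l: "l \<in> Omega n"
  shows "moduli_class n l \<in> symmetric_stratum n r \<longleftrightarrow>
    (\<exists>M\<in>Moeb. M \<noteq> id \<and> M ` marked_set n l = marked_set n l \<and>
      card {x \<in> marked_set n l. M x = x} = r)" (is "?L \<longleftrightarrow> ?R")
proof
  assume ?L
  then obtain S M where S: "moduli_class n l = sphere_class n S" "M \<in> Moeb" "M \<noteq> id" "M ` S = S"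
    "card {x \<in> S. M x = x} = r" unfolding symmetric_stratum_def by blast
  obtain N where N: "N \<in> Moeb" "N ` S = marked_set n l"
    using sphere_class_eqD[OF l] S(1) moduli_class_eq_sphere_class[OF n l] by metis
  obtain M' where "M' \<in> Moeb" "M' \<noteq> id" "M' ` marked_set n l = marked_set n l"
    "card {x \<in> marked_set n l. M' x = x} = card {x \<in> S. M x = x}"
    by (rule conjugate_symmetry[OF S(2-4) N])
  then show ?R unfolding S(5) by blast
next
  assume ?R
  then show ?L
    unfolding symmetric_stratum_def moduli_class_eq_sphere_class[OF n l]
    using card_marked_set[OF l] by blast
qed

lemma symmetric_stratum_subset_moduli:
  assumes "n \<ge> 2"
  shows "symmetric_stratum n r \<subseteq> moduli_class n ` Omega n"
proof
  fix x assume "x \<in> symmetric_stratum n r"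
  then obtain S where S: "x = sphere_class n S" "card S = n + 1"
    unfolding symmetric_stratum_def by blast
  obtain l M where l: "l \<in> Omega n" "M \<in> Moeb" "M ` S = marked_set n l"
    using sphere_class_representative[OF assms S(2)] .
  then have "x = moduli_class n l"
    using sphere_class_Moeb[OF l(2), of n S] moduli_class_eq_sphere_class[OF assms l(1)] S(1) by simp
  then show "x \<in> moduli_class n ` Omega n" using l(1) by blast
qed

lemma branch_locus_eq:
  assumes n: "n \<ge> 4"
  shows "branch_locus n = (\<Union>r\<le>2. symmetric_stratum n r)"
proof -
  have n2: "n \<ge> 2" using n by simp
  have iff: "stabilizer (moduli_group n) id l \<noteq> {\<one>\<^bsub>moduli_group n\<^esub>} \<longleftrightarrow>
      moduli_class n l \<in> (\<Union>r\<le>2. symmetric_stratum n r)" if l: "l \<in> Omega n" for l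
  proof -
    have "card {x \<in> marked_set n l. M x = x} \<le> 2" if "M \<in> Moeb" "M \<noteq> id" for M
      using finite_fixed_points[OF that]
      using card_mono[OF finite_fixed_points(1)[OF that], of "{x \<in> marked_set n l. M x = x}"]
      by (auto intro: le_trans)
    then show ?thesis
      unfolding nontrivial_stabilizer_iff[OF n l] UN_iff mem_symmetric_stratum_iff[OF n2 l] by blast
  qed
  show ?thesis
  proof (intro equalityI subsetI)
    fix x assume "x \<in> (\<Union>r\<le>2. symmetric_stratum n r)"
    then obtain l where "l \<in> Omega n" "x = moduli_class n l"
      using symmetric_stratum_subset_moduli[OF n2] by blast
    then show "x \<in> branch_locus n"
      using iff \<open>x \<in> (\<Union>r\<le>2. symmetric_stratum n r)\<close> unfolding branch_locus_def by blast
  next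
    fix x assume "x \<in> branch_locus n"
    then show "x \<in> (\<Union>r\<le>2. symmetric_stratum n r)"
      unfolding branch_locus_def using iff by blast
  qed
qed

section \<open>Connected families\<close>

lemma continuous_map_moduli_class:
  "continuous_map (Omega_topology n) (moduli_space n) (moduli_class n)"
  unfolding moduli_space_def
  by (rule quotient_imp_continuous_map[OF quotient_map_quotient_topology])

text \<open>The tuple is normalized by the affine map sending its second and third entry to \<open>0\<close> and \<open>1\<close>.\<close>

lemma connectedin_family_with_infinity:
  fixes Q :: "'i \<Rightarrow> complex \<Rightarrow> complex"
  assumes n: "n \<ge> 2" and T: "connected T" and I: "card I = n"
    and cont: "\<And>i. i \<in> I \<Longrightarrow> continuous_on T (Q i)"
    and inj: "\<And>t. t \<in> T \<Longrightarrow> inj_on (\<lambda>i. Q i t) I"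
  shows "connectedin (moduli_space n)
    ((\<lambda>t. sphere_class n (insert None (Some ` (\<lambda>i. Q i t) ` I))) ` T)"
proof -
  have "finite I" using n I card_ge_0_finite by force
  moreover have "card {2..n + 1} = card I" using I by simp
  ultimately obtain e where e: "bij_betw e {2..n + 1} I"
    using finite_same_card_bij[of "{2..n + 1}" I] by auto
  have eI: "e i \<in> I" if "i \<in> {2..n + 1}" for i using e that by (auto simp: bij_betw_def)
  have e2: "e 2 \<in> I" and e3: "e 3 \<in> I" using n by (auto intro: eI)
  have neQ: "Q (e i) t \<noteq> Q (e j) t" if "t \<in> T" "i \<in> {2..n + 1}" "j \<in> {2..n + 1}" "i \<noteq> j" for i j t
  proof -
    have "e i \<noteq> e j" using bij_betw_imp_inj_on[OF e] that by (auto dest: inj_onD)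
    then show ?thesis using inj_onD[OF inj[OF that(1)]] eI that by blast
  qed
  have ne32: "Q (e 3) t - Q (e 2) t \<noteq> 0" if "t \<in> T" for t
    using neQ[OF that, of 3 2] n by simp
  define A where "A t = sphere_moebius 1 (- Q (e 2) t) 0 (Q (e 3) t - Q (e 2) t)" for t
  define P where "P t i = (if i = 1 then None else A t (Some (Q (e i) t)))" for t i
  define l where "l t = (\<lambda>j\<in>{1..n - 2}. the (P t (j + 3)))" for t
  have A: "A t \<in> Moeb" if "t \<in> T" for t unfolding A_def using ne32[OF that] by (intro MoebI) simp
  have AN: "A t None = None" for t by (simp add: A_def sphere_moebius_def)
  have AS: "A t (Some z) = Some ((z - Q (e 2) t) / (Q (e 3) t - Q (e 2) t))" if "t \<in> T" for t z
    using ne32[OF that] by (simp add: A_def sphere_moebius_def moebius_def)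
  have Pinj: "inj_on (P t) {1..n + 1}" if t: "t \<in> T" for t
  proof (rule inj_onI)
    fix i j assume ij: "i \<in> {1..n + 1}" "j \<in> {1..n + 1}" "P t i = P t j"
    show "i = j"
    proof (rule ccontr)
      assume ne: "i \<noteq> j"
      show False
      proof (cases "i = 1 \<or> j = 1")
        case True
        then show False using ij(3) ne by (auto simp: P_def AS[OF t] split: if_splits)
      next
        case False
        then have "Q (e i) t = Q (e j) t"
          using ij(3) Moeb_eq_iff[OF A[OF t]] by (simp add: P_def)
        then show False using neQ[OF t _ _ ne] False ij(1,2) by auto
      qed
    qed
  qed
  have P: "P t 1 = None" "P t 2 = Some 0" "P t 3 = Some 1" if "t \<in> T" for t
    using ne32[OF that] by (simp_all add: P_def AS[OF that])
  have lO: "l t \<in> Omega n" and lP: "\<And>i. i \<in> {1..n + 1} \<Longrightarrow> marked_points (l t) i = P t i"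
    if "t \<in> T" for t
    unfolding l_def using normalized_tuple[OF n Pinj[OF that] P[OF that]] by blast+
  have cls_eq: "moduli_class n (l t) = sphere_class n (insert None (Some ` (\<lambda>i. Q i t) ` I))"
    if t: "t \<in> T" for t
  proof -
    have "{1..n + 1} = insert 1 {2..n + 1}" by auto
    then have "marked_set n (l t) = P t ` insert 1 {2..n + 1}"
      unfolding marked_set_def using lP[OF t] by (metis image_cong)
    also have "\<dots> = insert None ((\<lambda>i. A t (Some (Q (e i) t))) ` {2..n + 1})"
      by (auto simp: P_def image_iff)
    also have "\<dots> = A t ` insert None (Some ` (\<lambda>i. Q i t) ` e ` {2..n + 1})"
      by (simp add: AN image_image)
    also have "e ` {2..n + 1} = I" using e by (simp add: bij_betw_def)
    finally show ?thesis
      by (simp only: moduli_class_eq_sphere_class[OF n lO[OF t]] sphere_class_Moeb[OF A[OF t]])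
  qed
  have comp: "continuous_on T (\<lambda>t. l t j)" if j: "j \<in> {1..n - 2}" for j
  proof -
    have jI: "e (j + 3) \<in> I" using j n by (intro eI) auto
    have "continuous_on T (\<lambda>t. (Q (e (j + 3)) t - Q (e 2) t) / (Q (e 3) t - Q (e 2) t))"
      by (intro continuous_intros cont jI e2 e3) (use ne32 in auto)
    moreover have "l t j = (Q (e (j + 3)) t - Q (e 2) t) / (Q (e 3) t - Q (e 2) t)" if "t \<in> T" for t
      using j by (simp add: l_def P_def AS[OF that])
    ultimately show ?thesis by (metis (no_types, lifting) continuous_on_cong)
  qed
  have "continuous_map (top_of_set T) (product_topology (\<lambda>_. euclidean) {1..n - 2}) l"
    unfolding continuous_map_componentwise using comp by (auto simp: l_def)
  then have "continuous_map (top_of_set T) (Omega_topology n) l"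
    unfolding Omega_topology_def continuous_map_in_subtopology using lO by auto
  then have "continuous_map (top_of_set T) (moduli_space n) (moduli_class n \<circ> l)"
    by (rule continuous_map_compose[OF _ continuous_map_moduli_class])
  then have "connectedin (moduli_space n) ((moduli_class n \<circ> l) ` T)"
    by (rule connectedin_continuous_map_image) (simp add: connectedin_subtopology T)
  moreover have "(moduli_class n \<circ> l) ` T =
      (\<lambda>t. sphere_class n (insert None (Some ` (\<lambda>i. Q i t) ` I))) ` T"
    using cls_eq by (intro image_cong) auto
  ultimately show ?thesis by simp
qed

text \<open>One of the points is moved to infinity.\<close>

lemma connectedin_family_finite:
  fixes Q :: "'i \<Rightarrow> complex \<Rightarrow> complex"
  assumes n: "n \<ge> 2" and T: "connected T" and I: "card I = n + 1"
    and cont: "\<And>i. i \<in> I \<Longrightarrow> continuous_on T (Q i)"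
    and inj: "\<And>t. t \<in> T \<Longrightarrow> inj_on (\<lambda>i. Q i t) I"
  shows "connectedin (moduli_space n) ((\<lambda>t. sphere_class n (Some ` (\<lambda>i. Q i t) ` I)) ` T)"
proof -
  have "I \<noteq> {}" using I by auto
  then obtain i0 where i0: "i0 \<in> I" by blast
  define J where "J = I - {i0}"
  have finI: "finite I" using I card_ge_0_finite by force
  have J: "card J = n" using i0 I finI by (simp add: J_def)
  have ne: "Q i t - Q i0 t \<noteq> 0" if "t \<in> T" "i \<in> J" for i t
    using inj_onD[OF inj[OF that(1)], of i i0] that(2) i0 by (auto simp: J_def)
  define R where "R i t = 1 / (Q i t - Q i0 t)" for i t
  have contR: "continuous_on T (R i)" if "i \<in> J" for i
    unfolding R_def by (intro continuous_intros cont) (use ne that i0 in \<open>auto simp: J_def\<close>)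
  have injR: "inj_on (\<lambda>i. R i t) J" if t: "t \<in> T" for t
  proof (rule inj_onI)
    fix i j assume ij: "i \<in> J" "j \<in> J" "R i t = R j t"
    then have "Q i t = Q j t" using ne[OF t ij(1)] ne[OF t ij(2)] by (simp add: R_def field_simps)
    then show "i = j" using inj_onD[OF inj[OF t]] ij by (auto simp: J_def)
  qed
  have eq: "sphere_class n (insert None (Some ` (\<lambda>i. R i t) ` J)) = sphere_class n (Some ` (\<lambda>i. Q i t) ` I)"
    if t: "t \<in> T" for t
  proof -
    define A where "A = sphere_moebius 0 1 1 (- Q i0 t)"
    have A: "A \<in> Moeb" unfolding A_def by (intro MoebI) simp
    have I': "I = insert i0 J" using i0 by (auto simp: J_def)
    have "A (Some (Q i0 t)) = None" by (simp add: A_def sphere_moebius_def)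
    moreover have "A (Some (Q i t)) = Some (R i t)" if "i \<in> J" for i
      using ne[OF t that] by (simp add: A_def sphere_moebius_def moebius_def R_def)
    ultimately have "A ` Some ` (\<lambda>i. Q i t) ` I = insert None (Some ` (\<lambda>i. R i t) ` J)"
      unfolding I' by (auto simp: image_iff)
    then show ?thesis using sphere_class_Moeb[OF A] by metis
  qed
  have "connectedin (moduli_space n)
      ((\<lambda>t. sphere_class n (insert None (Some ` (\<lambda>i. R i t) ` J))) ` T)"
    by (rule connectedin_family_with_infinity[OF n T J contR injR])
  also have "(\<lambda>t. sphere_class n (insert None (Some ` (\<lambda>i. R i t) ` J))) ` T =
      (\<lambda>t. sphere_class n (Some ` (\<lambda>i. Q i t) ` I)) ` T"
    using eq by (rule image_cong[OF refl])
  finally show ?thesis .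
qed

lemma finite_interpolation_collisions:
  fixes u v :: "'i \<Rightarrow> complex"
  assumes "finite I" "inj_on u I"
  shows "finite {t. \<not> inj_on (\<lambda>i. u i + t * (v i - u i)) I}"
proof (rule finite_subset)
  show "{t. \<not> inj_on (\<lambda>i. u i + t * (v i - u i)) I} \<subseteq>
      (\<Union>(i, j)\<in>I \<times> I. {(u j - u i) / ((v i - u i) - (v j - u j))})"
  proof
    fix t assume "t \<in> {t. \<not> inj_on (\<lambda>i. u i + t * (v i - u i)) I}"
    then obtain i j where ij: "i \<in> I" "j \<in> I" "i \<noteq> j"
      "u i + t * (v i - u i) = u j + t * (v j - u j)" unfolding inj_on_def by blast
    then have t: "t * ((v i - u i) - (v j - u j)) = u j - u i" by (simp add: algebra_simps)
    moreover have "u j \<noteq> u i" using inj_onD[OF assms(2)] ij by blast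
    ultimately have "(v i - u i) - (v j - u j) \<noteq> 0" by auto
    then have "t = (u j - u i) / ((v i - u i) - (v j - u j))" using t by (metis nonzero_eq_divide_eq)
    then show "t \<in> (\<Union>(i, j)\<in>I \<times> I. {(u j - u i) / ((v i - u i) - (v j - u j))})"
      using ij by auto
  qed
qed (use assms in auto)

text \<open>Straight interpolation between two configurations avoids collisions outside a finite set of
  complex parameters, and the complement of a finite set in the plane is connected.\<close>

lemma connectedin_interpolation:
  fixes f :: "complex \<Rightarrow> complex"
  assumes n: "n \<ge> 2" and A: "finite A" "card A + card E = n + 1" and E: "E \<subseteq> {None}"
    and f: "inj_on f A"
  obtains C where "connectedin (moduli_space n) C"
    "sphere_class n (Some ` A \<union> E) \<in> C" "sphere_class n (Some ` f ` A \<union> E) \<in> C"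
    "\<And>x. x \<in> C \<Longrightarrow> \<exists>t. inj_on (\<lambda>z. z + t * (f z - z)) A \<and>
      x = sphere_class n (Some ` (\<lambda>z. z + t * (f z - z)) ` A \<union> E)"
proof -
  define T where "T = UNIV - {t. \<not> inj_on (\<lambda>z. z + t * (f z - z)) A}"
  have T: "connected T" unfolding T_def
    using finite_interpolation_collisions[OF A(1), of id f]
    by (intro connected_open_delete_finite) auto
  have inj: "inj_on (\<lambda>z. z + t * (f z - z)) A" if "t \<in> T" for t using that by (simp add: T_def)
  have T01: "0 \<in> T" "1 \<in> T" using f by (auto simp: T_def)
  define C where "C = (\<lambda>t. sphere_class n (Some ` (\<lambda>z. z + t * (f z - z)) ` A \<union> E)) ` T"
  have "connectedin (moduli_space n) C"
  proof (cases "E = {}")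
    case True
    have "connectedin (moduli_space n) ((\<lambda>t. sphere_class n (Some ` (\<lambda>z. z + t * (f z - z)) ` A)) ` T)"
      by (rule connectedin_family_finite[OF n T _ _ inj])
        (use A True in \<open>auto intro!: continuous_intros\<close>)
    then show ?thesis by (simp add: C_def True)
  next
    case False
    then have E': "E = {None}" using E by blast
    have "connectedin (moduli_space n)
        ((\<lambda>t. sphere_class n (insert None (Some ` (\<lambda>z. z + t * (f z - z)) ` A))) ` T)"
      by (rule connectedin_family_with_infinity[OF n T _ _ inj])
        (use A E' in \<open>auto intro!: continuous_intros\<close>)
    then show ?thesis by (simp add: C_def E')
  qed
  moreover have "sphere_class n (Some ` A \<union> E) \<in> C"
    unfolding C_def using T01(1) by (intro image_eqI[of _ _ 0]) auto
  moreover have "sphere_class n (Some ` f ` A \<union> E) \<in> C"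
    unfolding C_def using T01(2) by (intro image_eqI[of _ _ 1]) auto
  moreover have "\<exists>t. inj_on (\<lambda>z. z + t * (f z - z)) A \<and>
      x = sphere_class n (Some ` (\<lambda>z. z + t * (f z - z)) ` A \<union> E)" if "x \<in> C" for x
    using that inj unfolding C_def by blast
  ultimately show ?thesis using that by blast
qed

section \<open>Connectedness of the strata\<close>

lemma symmetric_stratum_normal_form:
  assumes n: "n \<ge> 2" and x: "x \<in> symmetric_stratum n r"
  obtains d Z where "d \<ge> 2" "finite Z" "0 \<notin> Z" "r \<le> 2" "d * card Z + r = n + 1"
    "x = sphere_class n (rotsym d Z r)"
proof -
  obtain S M where S: "card S = n + 1" "M \<in> Moeb" "M \<noteq> id" "M ` S = S"
    "card {x \<in> S. M x = x} = r" "x = sphere_class n S"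
    using x unfolding symmetric_stratum_def by blast
  have fin: "finite S" "card S \<ge> 3" using S(1) n card_ge_0_finite by force+
  obtain N d Z where N: "N \<in> Moeb" "d \<ge> 2" "finite Z" "0 \<notin> Z" "N ` S = rotsym d Z r" "r \<le> 2"
    using symmetric_set_normal_form[OF S(2-4) fin] unfolding S(5) by blast
  have "card (rotsym d Z r) = n + 1"
    using card_Moeb_image[OF N(1), of S] S(1) N(5) by simp
  then have "d * card Z + r = n + 1" using card_rotsym N by simp
  moreover have "x = sphere_class n (rotsym d Z r)"
    using sphere_class_Moeb[OF N(1), of n S] N(5) S(6) by simp
  ultimately show ?thesis using N(2-4,6) that by blast
qed

lemma rotsym_in_stratum:
  assumes "d \<ge> 2" "finite Z" "0 \<notin> Z" "r \<le> 2" "d * card Z + r = n + 1"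
  shows "sphere_class n (rotsym d Z r) \<in> symmetric_stratum n r"
proof -
  have d: "d > 0" using assms(1) by simp
  obtain a :: complex where a: "a \<noteq> 1" "a ^ d = 1" using obtain_root_of_unity[OF assms(1)] .
  have "a \<noteq> 0" using a d by (auto simp: power_0_left)
  have "rot a \<noteq> id"
  proof
    assume "rot a = id"
    then have "rot a (Some 1) = Some 1" by simp
    then show False using a(1) by simp
  qed
  moreover have "card {x \<in> rotsym d Z r. rot a x = x} = r"
    unfolding rot_fixed_rotsym[OF a(1) d assms(3)] by (rule card_poles[OF assms(4)])
  moreover have "card (rotsym d Z r) = n + 1" using card_rotsym[OF d assms(2-4)] assms(5) by simp
  ultimately show ?thesis
    using rot_rotsym[OF a(2) d, of Z r] rot_Moeb[OF \<open>a \<noteq> 0\<close>]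
    unfolding symmetric_stratum_def by blast
qed

text \<open>Multiplying \<open>z\<close> by a number that only depends on \<open>z\<^sup>d\<close> commutes with the rotations by
  \<open>d\<close>-th roots of unity, and a suitable choice of this factor realizes any bijection of the sets of
  \<open>d\<close>-th powers.\<close>

lemma equivariant_bijection:
  assumes d: "d > 0" and Z: "finite Z" "0 \<notin> Z" and W: "finite W" "0 \<notin> W" and "card Z = card W"
  obtains f :: "complex \<Rightarrow> complex" where "inj_on f (power_fibre d Z)"
    "f ` power_fibre d Z = power_fibre d W" "f 0 = 0"
    "\<And>a z. a ^ d = 1 \<Longrightarrow> f (a * z) = a * f z"
proof -
  obtain g where g: "bij_betw g Z W" using Z W assms(6) finite_same_card_bij by blast
  have gW: "g y \<in> W" if "y \<in> Z" for y using g that by (auto simp: bij_betw_def)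
  have "\<exists>u. u ^ d = g y / y" for y
  proof (cases "g y / y = 0")
    case True
    then show ?thesis using d by (intro exI[of _ 0]) (simp add: power_0_left)
  next
    case False
    have "card {z. z ^ d = g y / y} = d" using False d by (rule card_nth_roots)
    then have "{z. z ^ d = g y / y} \<noteq> {}" using d by force
    then show ?thesis by blast
  qed
  then obtain \<rho> where \<rho>: "\<rho> y ^ d = g y / y" for y by metis
  define f where "f z = z * \<rho> (z ^ d)" for z
  have fd: "f z ^ d = g (z ^ d)" if "z \<in> power_fibre d Z" for z
  proof -
    have "z ^ d \<noteq> 0" using that Z(2) unfolding power_fibre_def by (metis mem_Collect_eq)
    then show ?thesis by (simp add: f_def power_mult_distrib \<rho>)
  qed
  have inj: "inj_on f (power_fibre d Z)"
  proof (rule inj_onI)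
    fix z w assume zw: "z \<in> power_fibre d Z" "w \<in> power_fibre d Z" "f z = f w"
    then have "g (z ^ d) = g (w ^ d)" using fd by metis
    then have e: "z ^ d = w ^ d"
      using zw bij_betw_imp_inj_on[OF g] by (auto simp: power_fibre_def dest: inj_onD)
    have "g (z ^ d) \<in> W" using gW zw(1) by (simp add: power_fibre_def)
    then have "f z ^ d \<noteq> 0" using fd[OF zw(1)] W(2) by metis
    then have "f z \<noteq> 0" using d by (auto simp: power_0_left)
    then show "z = w" using zw(3) e by (auto simp: f_def)
  qed
  have "f ` power_fibre d Z \<subseteq> power_fibre d W"
    using fd gW by (auto simp: power_fibre_def)
  moreover have "card (f ` power_fibre d Z) = card (power_fibre d W)"
    using card_image[OF inj] finite_card_power_fibre(2)[OF d] Z W assms(6) by simp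
  ultimately have "f ` power_fibre d Z = power_fibre d W"
    using finite_card_power_fibre(1)[OF d W] card_subset_eq by blast
  moreover have "f (a * z) = a * f z" if "a ^ d = 1" for a z
    using that by (simp add: f_def power_mult_distrib)
  moreover have "f 0 = 0" by (simp add: f_def)
  ultimately show ?thesis using that inj by blast
qed

text \<open>Let \<open>f\<close> be an equivariant bijection from one configuration to the other.  At each time \<open>t\<close> the
  interpolation \<open>z \<mapsto> z + t (f z - z)\<close> commutes with the rotations as well, so that the configurations
  on the way keep the symmetry; by equivariance, a point that reaches the pole \<open>0\<close> collides with the
  points of its orbit, so this is excluded together with the other collisions.\<close>

lemma stratum_connects:
  assumes n: "n \<ge> 2" and d: "d \<ge> 2" and Z: "finite Z" "0 \<notin> Z" and W: "finite W" "0 \<notin> W"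
    and r: "r \<le> 2" and cZ: "d * card Z + r = n + 1" and cW: "d * card W + r = n + 1"
  obtains C where "connectedin (moduli_space n) C" "C \<subseteq> symmetric_stratum n r"
    "sphere_class n (rotsym d Z r) \<in> C" "sphere_class n (rotsym d W r) \<in> C"
proof -
  have d0: "d > 0" using d by simp
  have "d * card Z = d * card W" using cZ cW by linarith
  then have ceq: "card Z = card W" using d0 by simp
  obtain f where f: "inj_on f (power_fibre d Z)" "f ` power_fibre d Z = power_fibre d W" "f 0 = 0"
    "\<And>a z. a ^ d = 1 \<Longrightarrow> f (a * z) = a * f z"
    using equivariant_bijection[OF d0 Z W ceq] by blast
  define O2 where "O2 = (if r = 2 then {0::complex} else {})"
  define E where "E = (if r = 0 then {} else {None :: complex option})"
  define A where "A = power_fibre d Z \<union> O2"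
  have poles_eq: "poles r = Some ` O2 \<union> E" using r by (auto simp: poles_def O2_def E_def)
  have rs: "rotsym d V r = Some ` (power_fibre d V \<union> O2) \<union> E" for V
    unfolding rotsym_def poles_eq by blast
  have finA: "finite A" using finite_card_power_fibre(1)[OF d0 Z] by (simp add: A_def O2_def)
  have fA: "f ` A = power_fibre d W \<union> O2" using f(2,3) by (auto simp: A_def O2_def)
  have injA: "inj_on f A"
  proof -
    have "0 \<notin> f ` power_fibre d Z" unfolding f(2) by (rule zero_notin_power_fibre[OF d0 W(2)])
    then show ?thesis using f(1,3) by (auto simp: A_def O2_def inj_on_insert)
  qed
  have "card (Some ` A \<union> E) = n + 1"
    using card_rotsym[OF d0 Z r] cZ rs[of Z] by (simp add: A_def)
  moreover have "card (Some ` A \<union> E) = card A + card E"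
    using finA by (subst card_Un_disjoint) (auto simp: E_def card_image)
  ultimately have cAE: "card A + card E = n + 1" by simp
  have E: "E \<subseteq> {None}" by (simp add: E_def)
  obtain C where C: "connectedin (moduli_space n) C"
    "sphere_class n (Some ` A \<union> E) \<in> C" "sphere_class n (Some ` f ` A \<union> E) \<in> C"
    "\<And>x. x \<in> C \<Longrightarrow> \<exists>t. inj_on (\<lambda>z. z + t * (f z - z)) A \<and>
      x = sphere_class n (Some ` (\<lambda>z. z + t * (f z - z)) ` A \<union> E)"
    using connectedin_interpolation[OF n finA cAE E injA] by blast
  have "x \<in> symmetric_stratum n r" if xC: "x \<in> C" for x
  proof -
    obtain t where t: "inj_on (\<lambda>z. z + t * (f z - z)) A"
      "x = sphere_class n (Some ` (\<lambda>z. z + t * (f z - z)) ` A \<union> E)" using C(4)[OF xC] by blast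
    define h where "h = (\<lambda>z. z + t * (f z - z))"
    have hinj: "inj_on h A" using t(1) unfolding h_def .
    have h0: "h 0 = 0" by (simp add: h_def f(3))
    have heq: "h (a * z) = a * h z" if "a ^ d = 1" for a z
      by (simp add: h_def f(4)[OF that] algebra_simps)
    define B where "B = h ` power_fibre d Z"
    have rotF: "a * z \<in> power_fibre d Z" if "a ^ d = 1" "z \<in> power_fibre d Z" for a z
      using that by (simp add: power_fibre_def power_mult_distrib)
    have B0: "0 \<notin> B"
    proof
      assume "0 \<in> B"
      then obtain z where z: "z \<in> power_fibre d Z" "h z = 0" by (auto simp: B_def)
      obtain a :: complex where a: "a \<noteq> 1" "a ^ d = 1" using obtain_root_of_unity[OF d] .
      have "h (a * z) = h z" using heq[OF a(2)] z(2) by simp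
      moreover have "a * z \<in> A" "z \<in> A" using rotF[OF a(2) z(1)] z(1) by (simp_all add: A_def)
      ultimately have "a * z = z" using inj_onD[OF hinj] by blast
      then have "z = 0" using a(1) by simp
      then show False using z(1) zero_notin_power_fibre[OF d0 Z(2)] by simp
    qed
    define V where "V = (\<lambda>z. z ^ d) ` B"
    have finB: "finite B" using finA by (simp add: B_def A_def)
    have V: "finite V" "0 \<notin> V" using finB B0 d0 by (auto simp: V_def)
    have BV: "power_fibre d V = B"
    proof (intro equalityI subsetI)
      fix w assume "w \<in> power_fibre d V"
      then obtain z where z: "z \<in> power_fibre d Z" "w ^ d = h z ^ d"
        by (auto simp: power_fibre_def V_def B_def)
      have hz: "h z \<noteq> 0" using B0 z(1) by (auto simp: B_def)
      have a: "(w / h z) ^ d = 1" using z(2) hz by (simp add: power_divide)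
      have "w = h (w / h z * z)" using heq[OF a, of z] hz by simp
      then show "w \<in> B" unfolding B_def using rotF[OF a z(1)] by blast
    qed (auto simp: V_def power_fibre_def)
    have hA: "h ` A = power_fibre d V \<union> O2"
      unfolding BV B_def A_def using h0 by (auto simp: O2_def)
    have xV: "x = sphere_class n (rotsym d V r)"
      unfolding rs hA[symmetric] using t(2) unfolding h_def .
    have "card (rotsym d V r) = card (h ` A) + card E"
      unfolding rs hA[symmetric] using finA by (subst card_Un_disjoint) (auto simp: E_def card_image)
    also have "\<dots> = n + 1" using card_image[OF hinj] cAE by simp
    finally have "d * card V + r = n + 1" using card_rotsym[OF d0 V r] by simp
    then show ?thesis unfolding xV by (rule rotsym_in_stratum[OF d V r])
  qed
  moreover have "sphere_class n (rotsym d Z r) \<in> C" using C(2) unfolding rs A_def .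
  moreover have "sphere_class n (rotsym d W r) \<in> C" using C(3) unfolding rs fA .
  ultimately show ?thesis using that C(1) by blast
qed

text \<open>A regular polygon has rotations of every order \<open>d\<close> that occurs in its stratum, since \<open>d\<close> divides the
  number \<open>n + 1 - r\<close> of vertices.  So it is a common point of the connected pieces of the stratum that
  belong to the different \<open>d\<close>.\<close>

definition polygon_class :: "nat \<Rightarrow> nat \<Rightarrow> (nat \<Rightarrow> complex) set" where
  "polygon_class n r = sphere_class n (rotsym (n + 1 - r) {1} r)"

lemma polygon_class_in_stratum:
  assumes "n \<ge> 3" "r \<le> 2"
  shows "polygon_class n r \<in> symmetric_stratum n r"
  unfolding polygon_class_def by (rule rotsym_in_stratum) (use assms in auto)

lemma connectedin_symmetric_stratum:
  assumes n: "n \<ge> 3" and r: "r \<le> 2"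
  shows "connectedin (moduli_space n) (symmetric_stratum n r)"
proof -
  have n2: "n \<ge> 2" using n by simp
  define \<C> where "\<C> = {C. connectedin (moduli_space n) C \<and> C \<subseteq> symmetric_stratum n r \<and>
    polygon_class n r \<in> C}"
  have ex: "\<exists>C\<in>\<C>. x \<in> C" if x: "x \<in> symmetric_stratum n r" for x
  proof -
    obtain d Z where Z: "d \<ge> 2" "finite Z" "0 \<notin> Z" "r \<le> 2" "d * card Z + r = n + 1"
      "x = sphere_class n (rotsym d Z r)"
      using symmetric_stratum_normal_form[OF n2 x] .
    define k where "k = card Z"
    have dk: "d * k = n + 1 - r" using Z(5) by (simp add: k_def)
    have k: "k \<ge> 1" using dk n r by (cases k) auto
    \<comment> \<open>the \<open>d\<close>-th roots of the \<open>k\<close>-th roots of unity are the vertices of the polygon\<close>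
    define W where "W = {z::complex. z ^ k = 1}"
    have W: "finite W" "card W = k" "0 \<notin> W"
      using k by (auto simp: W_def card_roots_unity_eq power_0_left intro: finite_roots_unity)
    have "rotsym d W r = rotsym (n + 1 - r) {1} r"
      unfolding rotsym_def W_def power_fibre_roots_of_unity dk by (simp add: power_fibre_def)
    moreover have cW: "d * card W + r = n + 1" using W(2) Z(5) by (simp add: k_def)
    ultimately obtain C where "connectedin (moduli_space n) C" "C \<subseteq> symmetric_stratum n r"
      "x \<in> C" "polygon_class n r \<in> C"
      using stratum_connects[OF n2 Z(1-3) W(1,3) r Z(5) cW] unfolding Z(6) polygon_class_def by metis
    then show ?thesis unfolding \<C>_def by blast
  qed
  have "\<Inter>\<C> \<noteq> {}" using polygon_class_in_stratum[OF n r] unfolding \<C>_def by blast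
  then have "connectedin (moduli_space n) (\<Union>\<C>)"
    by (intro connectedin_Union) (auto simp: \<C>_def)
  moreover have "\<Union>\<C> = symmetric_stratum n r" using ex by (auto simp: \<C>_def)
  ultimately show ?thesis by simp
qed

section \<open>Common points of the strata\<close>

text \<open>The half turn \<open>z \<mapsto> 1/z\<close> preserves the regular polygon and exchanges the poles.  Of its fixed
  points \<open>1\<close> and \<open>-1\<close>, the latter is a vertex iff the number of vertices is even.\<close>

lemma polygon_class_in_other_stratum:
  assumes n: "n \<ge> 3" and r: "r = 0 \<or> r = 2"
  shows "polygon_class n r \<in> symmetric_stratum n (if odd n then 2 else 1)"
proof -
  define m where "m = n + 1 - r"
  have m: "m \<ge> 2" "even m \<longleftrightarrow> odd n" using n r by (auto simp: m_def)
  define J where "J = sphere_moebius 0 1 1 0"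
  have J: "J \<in> Moeb" unfolding J_def by (rule MoebI) simp
  have JN: "J None = Some 0" and J0: "J (Some 0) = None"
    and JS: "\<And>z. z \<noteq> 0 \<Longrightarrow> J (Some z) = Some (inverse z)"
    by (simp_all add: J_def sphere_moebius_def moebius_def field_simps)
  define S where "S = rotsym m {1} r"
  have m0: "m > 0" using m by simp
  have S_eq: "S = Some ` {z. z ^ m = 1} \<union> poles r" by (simp add: S_def rotsym_def power_fibre_def)
  have z0: "z \<noteq> 0" if "z ^ m = 1" for z :: complex using that m0 by (auto simp: power_0_left)
  have "J ` S \<subseteq> S"
  proof
    fix y assume "y \<in> J ` S"
    then obtain x where x: "x \<in> S" "y = J x" by blast
    from x(1) consider z where "x = Some z" "z ^ m = 1" | "x \<in> poles r" by (auto simp: S_eq)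
    then show "y \<in> S"
    proof cases
      case 1
      then show ?thesis using z0[OF 1(2)] JS x(2) by (simp add: S_eq power_inverse)
    next
      case 2
      then show ?thesis using r JN J0 x(2) by (auto simp: S_eq poles_def)
    qed
  qed
  moreover have finS: "finite S" unfolding S_def by (rule finite_rotsym[OF m0]) auto
  ultimately have JS': "J ` S = S" using inj_Moeb[OF J] by (simp add: endo_inj_surj)
  have Jne: "J \<noteq> id" using JN by auto
  have "{x \<in> S. J x = x} = Some ` {z. z ^ m = 1 \<and> z ^ 2 = 1}"
  proof (intro equalityI subsetI)
    fix x assume "x \<in> {x \<in> S. J x = x}"
    then have x: "x \<in> S" "J x = x" by auto
    have "x \<noteq> None" "x \<noteq> Some 0" using x(2) JN J0 by (metis option.distinct(1))+
    then have "x \<notin> poles r" by (simp add: poles_def)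
    then obtain z where z: "x = Some z" "z ^ m = 1" using x(1) by (auto simp: S_eq)
    then have "inverse z = z" using x(2) JS z0[OF z(2)] by simp
    then have "z ^ 2 = 1" using z0[OF z(2)] by (simp add: power2_eq_square field_simps)
    then show "x \<in> Some ` {z. z ^ m = 1 \<and> z ^ 2 = 1}" using z by blast
  next
    fix x assume "x \<in> Some ` {z::complex. z ^ m = 1 \<and> z ^ 2 = 1}"
    then obtain z where z: "x = Some z" "z ^ m = 1" "z ^ 2 = 1" by blast
    have "inverse z = z" using z(3) z0[OF z(2)] by (simp add: power2_eq_square field_simps)
    then show "x \<in> {x \<in> S. J x = x}" using z JS z0[OF z(2)] by (simp add: S_eq)
  qed
  also have "{z::complex. z ^ m = 1 \<and> z ^ 2 = 1} = (if even m then {1, -1} else {1})"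
    by (auto simp: power2_eq_1_iff)
  finally have "card {x \<in> S. J x = x} = (if odd n then 2 else 1)"
    using m(2) by (simp add: card_image)
  moreover have "card S = n + 1" unfolding S_def using card_rotsym[OF m0, of "{1}" r] r n
    by (auto simp: m_def)
  ultimately show ?thesis
    unfolding symmetric_stratum_def polygon_class_def m_def[symmetric] S_def[symmetric]
    using J Jne JS' by blast
qed

text \<open>For even \<open>n\<close> both polygons, with \<open>n + 1\<close> vertices and with \<open>n - 1\<close> vertices and both poles, have a half
  turn with exactly one fixed point in the configuration.\<close>

lemma connectedin_branch_locus_even:
  assumes n: "n \<ge> 4" and "even n"
  shows "connectedin (moduli_space n) (branch_locus n)"
proof -
  let ?C = "symmetric_stratum n"
  have n3: "n \<ge> 3" using n by simp
  have c: "connectedin (moduli_space n) (?C 0)" "connectedin (moduli_space n) (?C 1)"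
    "connectedin (moduli_space n) (?C 2)" by (rule connectedin_symmetric_stratum[OF n3]; simp)+
  have "?C 1 \<inter> ?C 0 \<noteq> {}" "(?C 1 \<union> ?C 0) \<inter> ?C 2 \<noteq> {}"
    using polygon_class_in_other_stratum[OF n3, of 0] polygon_class_in_other_stratum[OF n3, of 2]
      polygon_class_in_stratum[OF n3, of 0] polygon_class_in_stratum[OF n3, of 2] assms(2) by auto
  then have "connectedin (moduli_space n) (?C 1 \<union> ?C 0 \<union> ?C 2)"
    by (intro connectedin_Un c)
  moreover have "branch_locus n = ?C 1 \<union> ?C 0 \<union> ?C 2"
    unfolding branch_locus_eq[OF n] by (auto simp: atMost_nat_numeral atMost_Suc)
  ultimately show ?thesis by simp
qed

lemma connectedin_strata_0_2_odd:
  assumes n: "n \<ge> 3" and "odd n"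
  shows "connectedin (moduli_space n) (symmetric_stratum n 0 \<union> symmetric_stratum n 2)"
proof (rule connectedin_Un)
  have "polygon_class n 0 \<in> symmetric_stratum n 2"
    using polygon_class_in_other_stratum[OF n, of 0] assms(2) by simp
  moreover have "polygon_class n 0 \<in> symmetric_stratum n 0"
    by (rule polygon_class_in_stratum[OF n]) simp
  ultimately show "symmetric_stratum n 0 \<inter> symmetric_stratum n 2 \<noteq> {}" by blast
qed (rule connectedin_symmetric_stratum[OF n]; simp)+

section \<open>Tetrahedral configurations\<close>

text \<open>The tetrahedron has its vertices at \<open>\<infinity>\<close> and at the cube roots of unity; its rotation group is
  generated by \<open>z \<mapsto> \<omega> z\<close>, with \<open>\<omega>\<close> a primitive cube root of unity, and by the half turn
  \<open>z \<mapsto> (z + 2) / (z - 1)\<close>, which exchanges \<open>\<infinity>\<close> with \<open>1\<close>.  Besides the vertices, the orbits used here are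
  the six midpoints of the edges, which are the zeros of \<open>z\<^sup>6 - 20 z\<^sup>3 - 8\<close>, and the generic orbits of
  twelve points, which are the fibres of the invariant function \<open>z\<^sup>3 (z\<^sup>3 + 8)\<^sup>3 / (z\<^sup>3 - 1)\<^sup>3\<close>.  All
  of these are invariant under \<open>z \<mapsto> \<omega> z\<close>, hence given by the set of the cubes of their points.\<close>

definition edge_cubes :: "complex set" where
  "edge_cubes = {y. y ^ 2 - 20 * y - 8 = 0}"

definition generic_cubes :: "complex \<Rightarrow> complex set" where
  "generic_cubes c = {y. y * (y + 8) ^ 3 = c * (y - 1) ^ 3}"

definition tetra_map :: "complex option \<Rightarrow> complex option" where
  "tetra_map = sphere_moebius 1 2 1 (- 1)"

lemma quadratic_roots:
  fixes s b :: complex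
  shows "{y. (y - b) ^ 2 = s ^ 2} = {b + s, b - s}"
  by (auto simp: power2_eq_iff algebra_simps)

lemma card_edge_cubes: "finite edge_cubes" "card edge_cubes = 2"
proof -
  define s where "s = csqrt 108"
  have s2: "s ^ 2 = 108" unfolding s_def by (rule power2_csqrt)
  then have s: "s ^ 2 = 108" "s \<noteq> 0" by auto
  have "edge_cubes = {y. (y - 10) ^ 2 = s ^ 2}"
    unfolding edge_cubes_def s(1) by (rule Collect_cong) (auto simp: power2_eq_square algebra_simps)
  also have "\<dots> = {10 + s, 10 - s}" by (rule quadratic_roots)
  finally have e: "edge_cubes = {10 + s, 10 - s}" .
  have "10 + s \<noteq> 10 - s" using s(2) by (simp add: eq_neg_iff_add_eq_0[symmetric] algebra_simps)
  then show "finite edge_cubes" "card edge_cubes = 2" unfolding e by auto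
qed

lemma one_notin_edge_cubes: "1 \<notin> edge_cubes" and zero_notin_edge_cubes: "0 \<notin> edge_cubes"
  and one_notin_generic_cubes: "1 \<notin> generic_cubes c"
  and zero_notin_generic_cubes: "c \<noteq> 0 \<Longrightarrow> 0 \<notin> generic_cubes c"
  by (simp_all add: edge_cubes_def generic_cubes_def)

lemma generic_cubes_disjoint: "c \<noteq> c' \<Longrightarrow> generic_cubes c \<inter> generic_cubes c' = {}"
proof (rule ccontr)
  assume "c \<noteq> c'" "generic_cubes c \<inter> generic_cubes c' \<noteq> {}"
  then obtain y where y: "y \<in> generic_cubes c" "y \<in> generic_cubes c'" by blast
  then have "c * (y - 1) ^ 3 = c' * (y - 1) ^ 3" by (simp add: generic_cubes_def)
  moreover have "y \<noteq> 1" using y(1) one_notin_generic_cubes by blast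
  ultimately show False using \<open>c \<noteq> c'\<close> by simp
qed

text \<open>The finite values over which the invariant function may ramify.\<close>

definition special_values :: "complex set" where
  "special_values = insert 0 ((\<lambda>y. y * (y + 8) ^ 3 / (y - 1) ^ 3) ` edge_cubes)"

lemma finite_special_values: "finite special_values"
  by (simp add: special_values_def card_edge_cubes)

lemma generic_cubes_edge_cubes:
  assumes "c \<notin> special_values"
  shows "generic_cubes c \<inter> edge_cubes = {}"
proof (rule ccontr)
  assume "generic_cubes c \<inter> edge_cubes \<noteq> {}"
  then obtain y where y: "y \<in> generic_cubes c" "y \<in> edge_cubes" by blast
  have "y \<noteq> 1" using y(1) one_notin_generic_cubes by blast
  then have "c = y * (y + 8) ^ 3 / (y - 1) ^ 3" using y(1) by (simp add: generic_cubes_def)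
  then show False using assms y(2) by (auto simp: special_values_def)
qed

text \<open>The defining equation of the fibre is a quartic.  A double root of it is a critical point of the
  invariant function, so it equals \<open>-8\<close>, where the value is \<open>0\<close>, or it is the cube of a midpoint of an
  edge.\<close>

lemma card_generic_cubes:
  assumes c: "c \<notin> special_values"
  shows "finite (generic_cubes c)" "card (generic_cubes c) = 4"
proof -
  define p where "p = [:c, 512 - 3 * c, 192 + 3 * c, 24 - c, 1:]"
  have pv: "poly p y = y * (y + 8) ^ 3 - c * (y - 1) ^ 3" for y
    by (simp add: p_def algebra_simps power3_eq_cube)
  have pd: "poly (pderiv p) y = (y + 8) ^ 3 + 3 * y * (y + 8) ^ 2 - 3 * c * (y - 1) ^ 2" for y
    by (simp add: p_def pderiv_pCons algebra_simps power3_eq_cube power2_eq_square)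
  have roots: "generic_cubes c = {y. poly p y = 0}" by (simp add: generic_cubes_def pv)
  have deg: "degree p = 4" by (simp add: p_def)
  have p0: "p \<noteq> 0" by (simp add: p_def)
  have "rsquarefree p"
    unfolding rsquarefree_roots
  proof (intro allI notI)
    fix y assume "poly p y = 0 \<and> poly (pderiv p) y = 0"
    then have y: "y * (y + 8) ^ 3 = c * (y - 1) ^ 3"
      "(y + 8) ^ 3 + 3 * y * (y + 8) ^ 2 = 3 * c * (y - 1) ^ 2" by (simp_all add: pv pd)
    have "(y - 1) * ((y + 8) ^ 3 + 3 * y * (y + 8) ^ 2) = 3 * (c * (y - 1) ^ 3)"
      unfolding y(2) by (simp add: power3_eq_cube power2_eq_square)
    also have "\<dots> = 3 * (y * (y + 8) ^ 3)" by (simp add: y(1))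
    finally have "(y + 8) ^ 2 * (y ^ 2 - 20 * y - 8) = 0"
      by (simp add: algebra_simps power3_eq_cube power2_eq_square)
    then consider "y = - 8" | "y \<in> edge_cubes"
      by (auto simp: edge_cubes_def eq_neg_iff_add_eq_0)
    then show False
    proof cases
      case 1
      then have "c = 0" using y(1) by simp
      then show False using c by (simp add: special_values_def)
    next
      case 2
      moreover have "y \<in> generic_cubes c" using y(1) by (simp add: generic_cubes_def)
      ultimately show False using generic_cubes_edge_cubes[OF c] by blast
    qed
  qed
  then have dec: "smult (lead_coeff p) (\<Prod>z|poly p z = 0. [:- z, 1:]) = p"
    by (rule complex_poly_decompose_rsquarefree)
  show fin: "finite (generic_cubes c)" unfolding roots by (rule poly_roots_finite[OF p0])
  have "degree p = degree (\<Prod>z|poly p z = 0. [:- z, 1:])"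
    using p0 by (subst dec[symmetric]) simp
  also have "\<dots> = (\<Sum>z|poly p z = 0. degree [:- z, 1:])" by (rule degree_prod_eq_sum_degree) auto
  finally show "card (generic_cubes c) = 4" using deg by (simp add: roots)
qed

lemma tetra_map_values:
  "tetra_map None = Some 1" "tetra_map (Some 1) = None"
  "z \<noteq> 1 \<Longrightarrow> tetra_map (Some z) = Some ((z + 2) / (z - 1))"
  by (simp_all add: tetra_map_def sphere_moebius_def moebius_def)

text \<open>With \<open>u = z - 1\<close>, the half turn multiplies the forms \<open>z (z\<^sup>3 + 8)\<close> and \<open>z\<^sup>3 - 1\<close> of degree four by
  the same factor \<open>9 / u\<^sup>4\<close>, and the form \<open>z\<^sup>6 - 20 z\<^sup>3 - 8\<close> by \<open>- 27 / u\<^sup>6\<close>.\<close>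

lemma tetra_map_cubes:
  assumes "z \<noteq> 1"
  defines "w \<equiv> (z + 2) / (z - 1)"
  shows "z ^ 3 = 1 \<Longrightarrow> w ^ 3 = 1"
    and "z ^ 3 \<in> edge_cubes \<Longrightarrow> w ^ 3 \<in> edge_cubes"
    and "z ^ 3 \<in> generic_cubes c \<Longrightarrow> w ^ 3 \<in> generic_cubes c"
proof -
  define u where "u = z - 1"
  have u: "u \<noteq> 0" using assms(1) by (simp add: u_def)
  have wu: "w * u = z + 2" using u by (simp add: w_def u_def)
  show "w ^ 3 = 1" if "z ^ 3 = 1"
  proof -
    have "(z - 1) * (z ^ 2 + z + 1) = 0"
      using that by (simp add: algebra_simps power3_eq_cube power2_eq_square)
    then have q: "z ^ 2 + z + 1 = 0" using assms(1) by simp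
    have "(w * u) ^ 3 - u ^ 3 = 9 * (z ^ 2 + z + 1)"
      unfolding wu unfolding u_def by (simp add: algebra_simps power3_eq_cube power2_eq_square)
    then show ?thesis using q u by (simp add: power_mult_distrib)
  qed
  show "w ^ 3 \<in> edge_cubes" if "z ^ 3 \<in> edge_cubes"
  proof -
    have "(w * u) ^ 6 - 20 * ((w * u) ^ 3 * u ^ 3) - 8 * u ^ 6 = - 27 * ((z ^ 3) ^ 2 - 20 * z ^ 3 - 8)"
      unfolding wu unfolding u_def by (simp add: algebra_simps eval_nat_numeral)
    also have "\<dots> = 0" using that by (simp add: edge_cubes_def)
    also have "(w * u) ^ 6 - 20 * ((w * u) ^ 3 * u ^ 3) - 8 * u ^ 6 =
        u ^ 6 * ((w ^ 3) ^ 2 - 20 * w ^ 3 - 8)"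
      by (simp add: algebra_simps eval_nat_numeral)
    finally show ?thesis using u by (simp add: edge_cubes_def)
  qed
  show "w ^ 3 \<in> generic_cubes c" if "z ^ 3 \<in> generic_cubes c"
  proof -
    have a: "u ^ 4 * (w * (w ^ 3 + 8)) = 9 * (z * (z ^ 3 + 8))"
    proof -
      have "u ^ 4 * (w * (w ^ 3 + 8)) = (w * u) * ((w * u) ^ 3 + 8 * u ^ 3)"
        by (simp add: algebra_simps eval_nat_numeral)
      also have "\<dots> = 9 * (z * (z ^ 3 + 8))"
        unfolding wu unfolding u_def by (simp add: algebra_simps eval_nat_numeral)
      finally show ?thesis .
    qed
    have b: "u ^ 4 * (w ^ 3 - 1) = 9 * (z ^ 3 - 1)"
    proof -
      have "u ^ 4 * (w ^ 3 - 1) = u * ((w * u) ^ 3 - u ^ 3)"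
        by (simp add: algebra_simps eval_nat_numeral)
      also have "\<dots> = 9 * (z ^ 3 - 1)"
        unfolding wu unfolding u_def by (simp add: algebra_simps eval_nat_numeral)
      finally show ?thesis .
    qed
    have z: "(z * (z ^ 3 + 8)) ^ 3 = c * (z ^ 3 - 1) ^ 3"
      using that by (simp add: generic_cubes_def power_mult_distrib)
    have "(u ^ 4) ^ 3 * (w * (w ^ 3 + 8)) ^ 3 = (u ^ 4 * (w * (w ^ 3 + 8))) ^ 3"
      by (simp only: power_mult_distrib)
    also have "\<dots> = 9 ^ 3 * (z * (z ^ 3 + 8)) ^ 3" unfolding a by (simp only: power_mult_distrib)
    also have "\<dots> = c * (9 * (z ^ 3 - 1)) ^ 3" unfolding z by (simp only: power_mult_distrib mult_ac)
    also have "\<dots> = c * ((u ^ 4) ^ 3 * (w ^ 3 - 1) ^ 3)" unfolding b[symmetric] by (simp only: power_mult_distrib)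
    finally have "(u ^ 4) ^ 3 * (w * (w ^ 3 + 8)) ^ 3 = (u ^ 4) ^ 3 * (c * (w ^ 3 - 1) ^ 3)"
      by (simp only: mult_ac)
    then have "(w * (w ^ 3 + 8)) ^ 3 = c * (w ^ 3 - 1) ^ 3" using u by simp
    then show ?thesis by (simp add: generic_cubes_def power_mult_distrib)
  qed
qed

lemma tetra_map_fixed:
  "tetra_map x = x \<longleftrightarrow> (\<exists>z. x = Some z \<and> (z - 1) ^ 2 = 3)"
proof (cases x)
  case None
  then show ?thesis by (simp add: tetra_map_values)
next
  case (Some z)
  show ?thesis
  proof (cases "z = 1")
    case True
    then show ?thesis using Some by (simp add: tetra_map_values)
  next
    case False
    have "(z + 2) / (z - 1) = z \<longleftrightarrow> (z - 1) ^ 2 = 3"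
      using False by (auto simp: divide_eq_eq power2_eq_square algebra_simps)
    then show ?thesis using Some False by (simp add: tetra_map_values)
  qed
qed

text \<open>The axes of the half turns pass through the midpoints of opposite edges.\<close>

lemma tetra_map_fixed_edge:
  assumes "(z - 1) ^ 2 = 3"
  shows "z ^ 3 \<in> edge_cubes"
proof -
  have z2: "z * z = 2 * z + 2" using assms by (simp add: power2_eq_square algebra_simps)
  have "z ^ 3 = z * (z * z)" by (simp add: power3_eq_cube)
  also have "\<dots> = z * (2 * z + 2)" by (simp only: z2)
  also have "\<dots> = 2 * (z * z) + 2 * z" by (simp add: algebra_simps)
  also have "\<dots> = 6 * z + 4" unfolding z2 by (simp add: algebra_simps)
  finally have z3: "z ^ 3 = 6 * z + 4" .
  have "(z ^ 3) ^ 2 - 20 * z ^ 3 - 8 = 36 * (z * z) - 72 * z - 72"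
    unfolding z3 by (simp add: algebra_simps power2_eq_square)
  also have "\<dots> = 0" unfolding z2 by (simp add: algebra_simps)
  finally show ?thesis by (simp add: edge_cubes_def)
qed

text \<open>The number \<open>k = n / 3\<close> is odd, and the marked points other than \<open>\<infinity>\<close> need \<open>k\<close> cubes.  The vertices
  contribute the cube \<open>1\<close> and a generic orbit contributes four cubes, which suffices if \<open>k\<close> is \<open>1\<close> modulo
  \<open>4\<close>; otherwise the midpoints of the edges supply the two missing cubes.  The rotation of order three
  fixes \<open>\<infinity>\<close> and misses \<open>0\<close>, while the half turn has no or two fixed points in the set.\<close>

lemma strata_meet:
  assumes n: "odd n" "3 dvd n" "n \<ge> 6"
  shows "symmetric_stratum n 1 \<inter> (symmetric_stratum n 0 \<union> symmetric_stratum n 2) \<noteq> {}"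
proof -
  obtain k where k: "n = 3 * k" using n(2) by (elim dvdE)
  have "odd k" using n(1) k by simp
  define U where "U = (if k mod 4 = 3 then edge_cubes else {})"
  obtain Cs where Cs: "finite Cs" "card Cs = k div 4" "Cs \<subseteq> - special_values"
  proof -
    have "infinite (- special_values)" using finite_special_values infinite_UNIV_char_0
      by (metis Compl_eq_Diff_UNIV Diff_infinite_finite)
    then show ?thesis using that infinite_arbitrarily_large by metis
  qed
  define Y where "Y = {1} \<union> U \<union> (\<Union>c\<in>Cs. generic_cubes c)"
  have U: "finite U" "card U = (if k mod 4 = 3 then 2 else 0)" "U \<subseteq> edge_cubes"
    using card_edge_cubes by (auto simp: U_def)
  have Csp: "c \<notin> special_values" if "c \<in> Cs" for c using Cs(3) that by blast
  have fG: "finite (\<Union>c\<in>Cs. generic_cubes c)" using Cs(1) card_generic_cubes(1) Csp by blast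
  have "card (\<Union>c\<in>Cs. generic_cubes c) = (\<Sum>c\<in>Cs. card (generic_cubes c))"
    using Cs(1) card_generic_cubes(1) Csp generic_cubes_disjoint by (intro card_UN_disjoint) auto
  also have "\<dots> = (\<Sum>c\<in>Cs. 4)" using card_generic_cubes(2) Csp by (intro sum.cong) auto
  finally have cG: "card (\<Union>c\<in>Cs. generic_cubes c) = 4 * (k div 4)" using Cs(2) by simp
  have dUG: "U \<inter> (\<Union>c\<in>Cs. generic_cubes c) = {}" using U(3) generic_cubes_edge_cubes Csp by blast
  have d1: "1 \<notin> U \<union> (\<Union>c\<in>Cs. generic_cubes c)"
    using U(3) one_notin_edge_cubes one_notin_generic_cubes by blast
  have fY: "finite Y" using U(1) fG by (simp add: Y_def)
  have "card Y = 1 + (card U + 4 * (k div 4))"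
    using d1 card_Un_disjoint[OF U(1) fG dUG] U(1) fG cG by (simp add: Y_def)
  also have "\<dots> = k" using \<open>odd k\<close> U(2) by (cases "k mod 4 = 3") presburger+
  finally have cY: "card Y = k" .
  have Y0: "0 \<notin> Y"
  proof -
    have "c \<noteq> 0" if "c \<in> Cs" for c using Csp[OF that] by (auto simp: special_values_def)
    then show ?thesis using U(3) zero_notin_edge_cubes zero_notin_generic_cubes by (auto simp: Y_def)
  qed
  define S where "S = rotsym 3 Y 1"
  have S_eq: "S = insert None (Some ` power_fibre 3 Y)" by (simp add: S_def rotsym_def poles_def)
  have finS: "finite S" unfolding S_def by (rule finite_rotsym) (use fY Y0 in auto)
  have T: "tetra_map \<in> Moeb" unfolding tetra_map_def by (rule MoebI) simp
  have "tetra_map ` S \<subseteq> S"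
  proof
    fix y assume "y \<in> tetra_map ` S"
    then obtain x where x: "x \<in> S" "y = tetra_map x" by blast
    show "y \<in> S"
    proof (cases x)
      case None
      then show ?thesis using x(2) by (simp add: tetra_map_values S_eq power_fibre_def Y_def)
    next
      case (Some z)
      show ?thesis
      proof (cases "z = 1")
        case True
        then show ?thesis using x(2) Some by (simp add: tetra_map_values S_eq)
      next
        case False
        have "z ^ 3 \<in> Y" using x(1) Some by (auto simp: S_eq power_fibre_def)
        then have "((z + 2) / (z - 1)) ^ 3 \<in> Y"
          using tetra_map_cubes[OF False] unfolding Y_def U_def by (auto split: if_splits)
        then show ?thesis using x(2) Some False by (simp add: tetra_map_values S_eq power_fibre_def)
      qed
    qed
  qed
  then have TS: "tetra_map ` S = S" using inj_Moeb[OF T] finS by (simp add: endo_inj_surj)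
  have Tne: "tetra_map \<noteq> id" using tetra_map_values(1) by auto
  define r where "r = card {x \<in> S. tetra_map x = x}"
  have "r = 0 \<or> r = 2"
  proof (cases "k mod 4 = 3")
    case True
    have "{x \<in> S. tetra_map x = x} = Some ` {z. (z - 1) ^ 2 = 3}"
    proof (intro equalityI subsetI)
      fix x assume "x \<in> Some ` {z::complex. (z - 1) ^ 2 = 3}"
      then obtain z where z: "x = Some z" "(z - 1) ^ 2 = 3" by blast
      then show "x \<in> {x \<in> S. tetra_map x = x}"
        using tetra_map_fixed_edge[OF z(2)] True
        by (auto simp: tetra_map_fixed S_eq power_fibre_def Y_def U_def)
    qed (auto simp: tetra_map_fixed)
    moreover have "{z::complex. (z - 1) ^ 2 = 3} = {1 + csqrt 3, 1 - csqrt 3}"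
      using quadratic_roots[of 1 "csqrt 3"] unfolding power2_csqrt .
    moreover have "1 + csqrt 3 \<noteq> 1 - csqrt 3"
      by (simp add: eq_neg_iff_add_eq_0[symmetric] algebra_simps)
    ultimately show ?thesis by (simp add: r_def card_image)
  next
    case False
    have "{x \<in> S. tetra_map x = x} = {}"
    proof (rule ccontr)
      assume "{x \<in> S. tetra_map x = x} \<noteq> {}"
      then obtain z where z: "Some z \<in> S" "(z - 1) ^ 2 = 3" by (auto simp: tetra_map_fixed)
      have "z ^ 3 \<in> Y" using z(1) by (auto simp: S_eq power_fibre_def)
      moreover have "z ^ 3 \<in> edge_cubes" by (rule tetra_map_fixed_edge[OF z(2)])
      ultimately show False
        using False one_notin_edge_cubes generic_cubes_edge_cubes Csp unfolding Y_def U_def by auto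
    qed
    then have "r = 0" unfolding r_def by (simp only: card.empty)
    then show ?thesis by simp
  qed
  moreover have "sphere_class n S \<in> symmetric_stratum n r"
    unfolding symmetric_stratum_def r_def
    using T Tne TS card_rotsym[of 3 Y 1] fY Y0 cY k S_def by auto
  moreover have "sphere_class n S \<in> symmetric_stratum n 1"
    unfolding S_def by (rule rotsym_in_stratum) (use fY Y0 cY k in auto)
  ultimately show ?thesis by blast
qed

section \<open>Counting fixed points of a finite group of Moebius transformations\<close>

lemma two_fixed_points:
  assumes "M \<in> Moeb" "M \<noteq> id" "M ` S = S" "finite S" "card S \<ge> 3"
  shows "card {x. M x = x} = 2"
proof -
  obtain k where k: "k > 0" "M ^^ k = id" using Moeb_finite_order[OF assms(1,3-5)] .
  obtain N a where N: "N \<in> Moeb" "N \<circ> M = rot a \<circ> N" and a: "a \<noteq> 1"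
    using finite_order_conj_rotation[OF assms(1) k assms(2)] by blast
  have "M x = x \<longleftrightarrow> rot a (N x) = N x" for x
    using fun_cong[OF N(2), of x] Moeb_eq_iff[OF N(1), of "M x" x] by simp
  then have "M x = x \<longleftrightarrow> N x \<in> {None, Some 0}" for x using rot_fixed[OF a, of "N x"] by simp
  then have "N ` {x. M x = x} = {None, Some 0}"
    using Moeb_f_inv[OF N(1)] by (auto simp: image_iff) (metis Moeb_f_inv N(1))+
  then show ?thesis using card_Moeb_image[OF N(1), of "{x. M x = x}"] by simp
qed

definition orb :: "('a \<Rightarrow> 'a) set \<Rightarrow> 'a \<Rightarrow> 'a set" where
  "orb G x = (\<lambda>g. g x) ` G"

definition stab :: "('a \<Rightarrow> 'a) set \<Rightarrow> 'a \<Rightarrow> ('a \<Rightarrow> 'a) set" where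
  "stab G x = {g \<in> G. g x = x}"

locale finite_transformation_group =
  fixes G :: "('a \<Rightarrow> 'a) set"
  assumes finite_G: "finite G"
    and id_G: "id \<in> G"
    and comp_G: "g \<in> G \<Longrightarrow> h \<in> G \<Longrightarrow> g \<circ> h \<in> G"
    and inv_G: "g \<in> G \<Longrightarrow> \<exists>h\<in>G. h \<circ> g = id \<and> g \<circ> h = id"
begin

lemma self_in_orb: "x \<in> orb G x"
  unfolding orb_def using id_G by (metis id_apply image_eqI)

lemma finite_orb: "finite (orb G x)"
  by (simp add: orb_def finite_G)

lemma orb_subset: "y \<in> orb G x \<Longrightarrow> orb G y \<subseteq> orb G x"
  unfolding orb_def using comp_G by (auto simp: image_iff) (metis comp_apply)

lemma orb_sym: "y \<in> orb G x \<Longrightarrow> x \<in> orb G y"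
proof -
  assume "y \<in> orb G x"
  then obtain g where g: "g \<in> G" "y = g x" by (auto simp: orb_def)
  obtain h where h: "h \<in> G" "h \<circ> g = id" using inv_G[OF g(1)] by blast
  have "h y = x" using fun_cong[OF h(2), of x] g(2) by simp
  then show "x \<in> orb G y" unfolding orb_def using h(1) by blast
qed

lemma orb_eq: "y \<in> orb G x \<Longrightarrow> orb G y = orb G x"
  using orb_subset[of y x] orb_subset[of x y] orb_sym[of y x] by blast

lemma orb_disjoint: "y \<notin> orb G x \<Longrightarrow> orb G x \<inter> orb G y = {}"
  using orb_eq orb_sym self_in_orb by blast

lemma card_orb_stab: "card (orb G x) * card (stab G x) = card G"
proof -
  have fibre: "card {g \<in> G. g x = y} = card (stab G x)" if "y \<in> orb G x" for y
  proof -
    obtain g where g: "g \<in> G" "y = g x" using \<open>y \<in> orb G x\<close> by (auto simp: orb_def)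
    obtain h where h: "h \<in> G" "h \<circ> g = id" "g \<circ> h = id" using inv_G[OF g(1)] by blast
    have hg: "h (g z) = z" "g (h z) = z" for z
      using fun_cong[OF h(2), of z] fun_cong[OF h(3), of z] by simp_all
    have "bij_betw (\<lambda>f. g \<circ> f) (stab G x) {g \<in> G. g x = y}"
    proof (rule bij_betwI[of _ _ _ "\<lambda>f. h \<circ> f"])
      show "(\<lambda>f. g \<circ> f) \<in> stab G x \<rightarrow> {g \<in> G. g x = y}"
        using g comp_G by (auto simp: stab_def)
      show "(\<lambda>f. h \<circ> f) \<in> {g \<in> G. g x = y} \<rightarrow> stab G x"
        using g h(1) comp_G hg(1) by (auto simp: stab_def)
    qed (auto simp: fun_eq_iff hg)
    then show ?thesis by (simp add: bij_betw_same_card)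
  qed
  have "card G = (\<Sum>g\<in>G. 1)" by simp
  also have "\<dots> = (\<Sum>y\<in>orb G x. \<Sum>g\<in>{g \<in> G. g x = y}. 1)"
    unfolding orb_def by (rule sum.image_gen[OF finite_G])
  also have "\<dots> = (\<Sum>y\<in>orb G x. card (stab G x))" by (rule sum.cong) (simp_all add: fibre)
  finally show ?thesis by simp
qed

lemma sum_stab_orb: "(\<Sum>y\<in>orb G x. card (stab G y)) = card G"
proof -
  have pos: "card (orb G x) > 0"
    using self_in_orb[of x] finite_orb[of x] card_gt_0_iff by blast
  have "card (stab G y) = card (stab G x)" if "y \<in> orb G x" for y
    using card_orb_stab[of y] card_orb_stab[of x] orb_eq[OF that] pos
    by (metis mult_left_cancel less_not_refl)
  then show ?thesis using card_orb_stab[of x] by simp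
qed

lemma sum_stab_eq_fixed_points:
  assumes "finite X"
  shows "(\<Sum>x\<in>X. card (stab G x)) = card X + (\<Sum>g\<in>G - {id}. card {x \<in> X. g x = x})"
proof -
  have "(\<Sum>x\<in>X. card (stab G x)) = (\<Sum>x\<in>X. \<Sum>g\<in>G. if g x = x then 1 else 0)"
    unfolding stab_def using finite_G by (intro sum.cong) (auto simp: sum.If_cases Int_def)
  also have "\<dots> = (\<Sum>g\<in>G. \<Sum>x\<in>X. if g x = x then 1 else 0)" by (rule sum.swap)
  also have "\<dots> = (\<Sum>g\<in>G. card {x \<in> X. g x = x})"
    using assms by (intro sum.cong) (auto simp: sum.If_cases Int_def)
  also have "\<dots> = card X + (\<Sum>g\<in>G - {id}. card {x \<in> X. g x = x})"
    using sum.remove[OF finite_G id_G, of "\<lambda>g. card {x \<in> X. g x = x}"] by simp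
  finally show ?thesis .
qed

text \<open>Every transformation other than the identity having two fixed points, an orbit of length \<open>m\<close>
  contributes \<open>N - m\<close> to the total of \<open>2 (N - 1)\<close> fixed points, where \<open>N\<close> is the order of the
  group.  If two orbits have stabilizers of order at least five, then they contribute at least
  \<open>8 N / 5\<close>, which leaves no room for the \<open>N / 2\<close> of a third orbit of fixed points.  Then the two
  orbits contribute everything, and both are singletons.\<close>

lemma large_stabilizers_imp_fixed:
  assumes two: "\<And>g. g \<in> G \<Longrightarrow> g \<noteq> id \<Longrightarrow> card {x. g x = x} = 2"
    and ab: "b \<notin> orb G a" "card (stab G a) \<ge> 5" "card (stab G b) \<ge> 5"
    and g: "g \<in> G"
  shows "g a = a" "g b = b"
proof -
  define A B N where "A = card (orb G a)" and "B = card (orb G b)" and "N = card G"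
  have N0: "N > 0" unfolding N_def using finite_G id_G card_gt_0_iff by blast
  have A5: "5 * A \<le> N" and B5: "5 * B \<le> N"
    using card_orb_stab[of a] card_orb_stab[of b] ab(2,3) mult_le_mono2[of 5 _ A] mult_le_mono2[of 5 _ B]
    unfolding A_def B_def N_def by (metis mult.commute)+
  have fin2: "finite {x. h x = x}" if "h \<in> G" "h \<noteq> id" for h
    using two[OF that] card.infinite by fastforce
  have cG: "card (G - {id}) = N - 1" unfolding N_def using finite_G id_G by simp
  have sum2: "(\<Sum>h\<in>G - {id}. card {x. h x = x}) = 2 * (N - 1)"
    using two cG by simp
  have disAB: "orb G a \<inter> orb G b = {}" by (rule orb_disjoint[OF ab(1)])
  have fAB: "finite (orb G a \<union> orb G b)" using finite_orb by simp
  have cAB: "card (orb G a \<union> orb G b) = A + B"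
    using disAB finite_orb by (simp add: A_def B_def card_Un_disjoint)
  have TAB: "(\<Sum>x\<in>orb G a \<union> orb G b. card (stab G x)) = 2 * N"
    using disAB finite_orb sum_stab_orb by (simp add: sum.union_disjoint N_def)
  have poles: "x \<in> orb G a \<union> orb G b" if h: "h \<in> G" "h \<noteq> id" "h x = x" for h x
  proof (rule ccontr)
    assume x: "x \<notin> orb G a \<union> orb G b"
    define C where "C = card (orb G x)"
    have "{id, h} \<subseteq> stab G x" using h id_G by (auto simp: stab_def)
    moreover have "finite (stab G x)" using finite_G by (simp add: stab_def)
    ultimately have "card {id, h} \<le> card (stab G x)" by (intro card_mono)
    then have "2 \<le> card (stab G x)" using h(2) by simp
    then have C2: "2 * C \<le> N" using card_orb_stab[of x] mult_le_mono2[of 2 _ C]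
      unfolding C_def N_def by (metis mult.commute)
    let ?X = "(orb G a \<union> orb G b) \<union> orb G x"
    have dis: "(orb G a \<union> orb G b) \<inter> orb G x = {}" using orb_disjoint x by blast
    have "3 * N = (\<Sum>x\<in>?X. card (stab G x))"
      using sum.union_disjoint[OF fAB finite_orb dis, of "\<lambda>x. card (stab G x)"] TAB
        sum_stab_orb[of x] by (simp add: N_def)
    also have "\<dots> = card ?X + (\<Sum>h\<in>G - {id}. card {x \<in> ?X. h x = x})"
      by (rule sum_stab_eq_fixed_points) (use fAB finite_orb in simp)
    also have "card ?X = A + B + C"
      using card_Un_disjoint[OF fAB finite_orb dis] cAB by (simp add: C_def)
    also have "(\<Sum>h\<in>G - {id}. card {x \<in> ?X. h x = x}) \<le> (\<Sum>h\<in>G - {id}. card {x. h x = x})"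
      using fin2 by (intro sum_mono card_mono) auto
    finally have "3 * N \<le> A + B + C + 2 * (N - 1)" using sum2 by simp
    then show False using A5 B5 C2 N0 by linarith
  qed
  have "2 * N = card (orb G a \<union> orb G b) + (\<Sum>h\<in>G - {id}. card {x \<in> orb G a \<union> orb G b. h x = x})"
    using sum_stab_eq_fixed_points[OF fAB] TAB by simp
  also have "(\<Sum>h\<in>G - {id}. card {x \<in> orb G a \<union> orb G b. h x = x}) = (\<Sum>h\<in>G - {id}. card {x. h x = x})"
    using poles by (intro sum.cong arg_cong[of _ _ card]) blast+
  finally have "A + B = 2" using sum2 cAB N0 by simp
  moreover have "A > 0" "B > 0"
    unfolding A_def B_def using self_in_orb finite_orb card_gt_0_iff by blast+
  ultimately have "card (orb G a) = 1" "card (orb G b) = 1" by (simp_all add: A_def B_def)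
  then have "orb G a = {a}" "orb G b = {b}" using self_in_orb by (metis card_1_singletonE singletonD)+
  then show "g a = a" "g b = b" using g unfolding orb_def by blast+
qed

end

lemma symmetry_group_is_finite_group:
  assumes "finite S" "card S \<ge> 3"
  shows "finite_transformation_group {M \<in> Moeb. M ` S = S}"
proof
  show "finite {M \<in> Moeb. M ` S = S}"
    by (rule finite_subset[OF _ finite_Moeb_maps_to[OF assms(1,1,2)]]) auto
  show "id \<in> {M \<in> Moeb. M ` S = S}" by simp
  show "g \<circ> h \<in> {M \<in> Moeb. M ` S = S}"
    if "g \<in> {M \<in> Moeb. M ` S = S}" "h \<in> {M \<in> Moeb. M ` S = S}" for g h
    using that Moeb_comp by (auto simp only: mem_Collect_eq image_comp[symmetric])
  show "\<exists>h\<in>{M \<in> Moeb. M ` S = S}. h \<circ> g = id \<and> g \<circ> h = id" if "g \<in> {M \<in> Moeb. M ` S = S}" for g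
  proof -
    have g: "g \<in> Moeb" "g ` S = S" using that by auto
    have "inv_into UNIV g ` S = S" using Moeb_inv_image[OF g(1), of S] g(2) by simp
    then have "inv_into UNIV g \<in> {M \<in> Moeb. M ` S = S}" using inv_Moeb[OF g(1)] by simp
    moreover have "inv_into UNIV g \<circ> g = id" "g \<circ> inv_into UNIV g = id"
      using g(1) by (simp_all add: fun_eq_iff)
    ultimately show ?thesis by blast
  qed
qed

lemma coprime_six_divisor:
  fixes n d :: nat
  assumes "odd n" "\<not> 3 dvd n" "d dvd n" "d \<ge> 2"
  shows "d \<ge> 5"
proof (rule ccontr)
  assume "\<not> d \<ge> 5"
  then have "d = 2 \<or> d = 3 \<or> d = 4" using assms(4) by auto
  moreover have "even n" if "4 dvd n" using that dvd_trans[of 2 4 n] by simp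
  ultimately show False using assms by auto
qed

text \<open>For \<open>n\<close> prime to \<open>6\<close>, a rotation with exactly one fixed point among the \<open>n + 1\<close> points has order
  at least five.  Its fixed points \<open>\<infinity>\<close>, in the set, and \<open>0\<close>, outside the set, lie in different orbits
  of the symmetry group, hence are fixed by the whole group.\<close>

lemma strata_disjoint:
  assumes n: "n \<ge> 4" "odd n" "\<not> 3 dvd n" and r: "r \<noteq> 1"
  shows "symmetric_stratum n 1 \<inter> symmetric_stratum n r = {}"
proof (rule ccontr)
  assume "symmetric_stratum n 1 \<inter> symmetric_stratum n r \<noteq> {}"
  then obtain x where x: "x \<in> symmetric_stratum n 1" "x \<in> symmetric_stratum n r" by blast
  have n2: "n \<ge> 2" using n by simp
  obtain l where l: "l \<in> Omega n" "x = moduli_class n l"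
    using symmetric_stratum_subset_moduli[OF n2] x(1) by blast
  let ?L = "marked_set n l"
  have cL: "card ?L = n + 1" "card ?L \<ge> 3" "finite ?L"
    using card_marked_set[OF l(1)] n finite_marked_set by simp_all
  obtain M1 where M1: "M1 \<in> Moeb" "M1 \<noteq> id" "M1 ` ?L = ?L" "card {x \<in> ?L. M1 x = x} = 1"
    using x(1) mem_symmetric_stratum_iff[OF n2 l(1)] l(2) by blast
  obtain M2 where M2: "M2 \<in> Moeb" "M2 \<noteq> id" "M2 ` ?L = ?L" "card {x \<in> ?L. M2 x = x} = r"
    using x(2) mem_symmetric_stratum_iff[OF n2 l(1)] l(2) by blast
  obtain N d Z where N: "N \<in> Moeb" "d \<ge> 2" "finite Z" "0 \<notin> Z" "N ` ?L = rotsym d Z 1" "1 \<le> (2::nat)"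
    using symmetric_set_normal_form[OF M1(1-3) cL(3,2)] unfolding M1(4) .
  define S where "S = rotsym d Z 1"
  have d0: "d > 0" using N(2) by simp
  have cS: "card S = n + 1" using card_Moeb_image[OF N(1), of ?L] N(5) cL(1) by (simp add: S_def)
  have finS: "finite S" "card S \<ge> 3" using finite_rotsym[OF d0 N(3,4)] cS n by (simp_all add: S_def)
  obtain M where M: "M \<in> Moeb" "M \<noteq> id" "M ` S = S" "card {x \<in> S. M x = x} = card {x \<in> ?L. M2 x = x}"
    by (rule conjugate_symmetry[OF M2(1-3) N(1) N(5)[folded S_def]])
  have "d * card Z + 1 = n + 1" using card_rotsym[OF d0 N(3,4), of 1] cS by (simp add: S_def)
  then have "d dvd n" by (metis add_right_cancel dvd_triv_left)
  then have d5: "d \<ge> 5" using coprime_six_divisor n N(2) by blast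
  define G where "G = {M \<in> Moeb. M ` S = S}"
  interpret finite_transformation_group G
    unfolding G_def by (rule symmetry_group_is_finite_group[OF finS])
  have two: "card {x. g x = x} = 2" if "g \<in> G" "g \<noteq> id" for g
    using two_fixed_points that finS unfolding G_def by blast
  have NS: "None \<in> S" and S0: "Some 0 \<notin> S"
    using zero_notin_power_fibre[OF d0 N(4)] by (auto simp: S_def rotsym_def poles_def)
  have notorb: "Some 0 \<notin> orb G None"
  proof
    assume "Some 0 \<in> orb G None"
    then obtain g where "g ` S = S" "Some 0 = g None" unfolding orb_def G_def by blast
    then show False using NS S0 by (metis image_eqI)
  qed
  have roots: "card {a::complex. a ^ d = 1} = d" using d5 by (intro card_roots_unity_eq) simp
  have injrot: "inj_on rot {a::complex. a ^ d = 1}"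
  proof (rule inj_onI)
    fix a b :: complex assume "rot a = rot b"
    then have "rot a (Some 1) = rot b (Some 1)" by simp
    then show "a = b" by simp
  qed
  have rots: "rot ` {a. a ^ d = 1} \<subseteq> stab G p" if "p = None \<or> p = Some 0" for p
  proof
    fix f assume "f \<in> rot ` {a::complex. a ^ d = 1}"
    then obtain a :: complex where a: "a ^ d = 1" "f = rot a" by blast
    have "a \<noteq> 0" using a(1) d0 by (auto simp: power_0_left)
    then show "f \<in> stab G p"
      using that a rot_Moeb rot_rotsym[OF a(1) d0, of Z 1] by (auto simp: stab_def G_def S_def)
  qed
  have big: "card (stab G p) \<ge> 5" if "p = None \<or> p = Some 0" for p
  proof -
    have "finite (stab G p)" using finite_G by (simp add: stab_def)
    from card_mono[OF this rots[OF that]] show ?thesis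
      using card_image[OF injrot] roots d5 by simp
  qed
  have MG: "M \<in> G" using M by (simp add: G_def)
  have fixed: "M None = None" "M (Some 0) = Some 0"
    using large_stabilizers_imp_fixed[OF two notorb big big MG] by auto
  have "{None, Some 0} = {x. M x = x}"
    by (rule card_subset_eq) (use fixed finite_fixed_points[OF M(1,2)] two[OF MG M(2)] in auto)
  then have "{x \<in> S. M x = x} = {None}" using NS S0 by auto
  then have "r = 1" using M(4) M2(4) by simp
  then show False using r by simp
qed

section \<open>Closedness of the strata\<close>

lemma continuous_map_cmult:
  fixes f g :: "'a \<Rightarrow> complex"
  shows "continuous_map X euclidean f \<Longrightarrow> continuous_map X euclidean g \<Longrightarrow>
    continuous_map X euclidean (\<lambda>x. f x * g x)"
  by (simp add: continuous_map_atin tendsto_mult)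

lemma continuous_map_cadd:
  fixes f g :: "'a \<Rightarrow> complex"
  shows "continuous_map X euclidean f \<Longrightarrow> continuous_map X euclidean g \<Longrightarrow>
    continuous_map X euclidean (\<lambda>x. f x + g x)"
  by (simp add: continuous_map_atin tendsto_add)

lemma continuous_map_cdiff:
  fixes f g :: "'a \<Rightarrow> complex"
  shows "continuous_map X euclidean f \<Longrightarrow> continuous_map X euclidean g \<Longrightarrow>
    continuous_map X euclidean (\<lambda>x. f x - g x)"
  by (simp add: continuous_map_atin tendsto_diff)

text \<open>Homogeneous coordinates of the marked points, polynomial in the coordinates of the tuple.\<close>

definition hx :: "(nat \<Rightarrow> complex) \<Rightarrow> nat \<Rightarrow> complex" where
  "hx l i = (if i = 1 then 1 else if i = 2 then 0 else if i = 3 then 1 else l (i - 3))"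

definition hy :: "(nat \<Rightarrow> complex) \<Rightarrow> nat \<Rightarrow> complex" where
  "hy l i = (if i = 1 then 0 else 1)"

definition hdet :: "(nat \<Rightarrow> complex) \<Rightarrow> nat \<Rightarrow> nat \<Rightarrow> complex" where
  "hdet l i j = hx l i * hy l j - hx l j * hy l i"

lemma marked_points_hpoint: "marked_points l i = hpoint (hx l i) (hy l i)"
  by (simp add: marked_points_def hx_def hy_def hpoint_def)

lemma hcoords_nonzero: "hx l i \<noteq> 0 \<or> hy l i \<noteq> 0"
  by (simp add: hx_def hy_def)

lemma hdet_nonzero:
  assumes "l \<in> Omega n" "i \<in> {1..n + 1}" "j \<in> {1..n + 1}" "i \<noteq> j"
  shows "hdet l i j \<noteq> 0"
proof -
  have "marked_points l i \<noteq> marked_points l j"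
    using inj_onD[OF inj_on_marked_points[OF assms(1)]] assms(2-4) by blast
  then show ?thesis
    unfolding marked_points_hpoint hpoint_eq_iff[OF hcoords_nonzero hcoords_nonzero] hdet_def by simp
qed

text \<open>The matrix whose columns are the homogeneous coordinates of the points with labels \<open>\<sigma> 1\<close> and \<open>\<sigma> 2\<close>,
  scaled by the determinants \<open>(\<sigma> 3, \<sigma> 2)\<close> and \<open>(\<sigma> 1, \<sigma> 3)\<close>, maps \<open>(1, 0)\<close>, \<open>(0, 1)\<close> and, by the
  Pluecker relation, \<open>(1, 1)\<close> to multiples of the coordinates of the points \<open>\<sigma> 1\<close>, \<open>\<sigma> 2\<close> and \<open>\<sigma> 3\<close>.  The
  defect measures whether it also maps the point \<open>i\<close> to the point \<open>\<sigma> i\<close>.  It is polynomial in the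
  tuple, so that its vanishing is a closed condition.\<close>

definition transfer_defect :: "(nat \<Rightarrow> nat) \<Rightarrow> (nat \<Rightarrow> complex) \<Rightarrow> nat \<Rightarrow> complex" where
  "transfer_defect \<sigma> l i =
    (hdet l (\<sigma> 3) (\<sigma> 2) * hx l (\<sigma> 1) * hx l i + hdet l (\<sigma> 1) (\<sigma> 3) * hx l (\<sigma> 2) * hy l i) * hy l (\<sigma> i) -
    hx l (\<sigma> i) *
    (hdet l (\<sigma> 3) (\<sigma> 2) * hy l (\<sigma> 1) * hx l i + hdet l (\<sigma> 1) (\<sigma> 3) * hy l (\<sigma> 2) * hy l i)"

lemma transfer_iff_defect_zero:
  assumes n: "n \<ge> 2" and l: "l \<in> Omega n" and \<sigma>: "\<sigma> permutes {1..n + 1}"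
  shows "(\<exists>M\<in>Moeb. \<forall>i\<in>{1..n + 1}. M (marked_points l i) = marked_points l (\<sigma> i)) \<longleftrightarrow>
    (\<forall>i\<in>{1..n + 1}. transfer_defect \<sigma> l i = 0)"
proof -
  let ?I = "{1..n + 1}"
  define a b c d where
    "a = hdet l (\<sigma> 3) (\<sigma> 2) * hx l (\<sigma> 1)" and "b = hdet l (\<sigma> 1) (\<sigma> 3) * hx l (\<sigma> 2)" and
    "c = hdet l (\<sigma> 3) (\<sigma> 2) * hy l (\<sigma> 1)" and "d = hdet l (\<sigma> 1) (\<sigma> 3) * hy l (\<sigma> 2)"
  have I: "1 \<in> ?I" "2 \<in> ?I" "3 \<in> ?I" using n by auto
  have \<sigma>I: "\<sigma> i \<in> ?I" if "i \<in> ?I" for i using permutes_in_image[OF \<sigma>] that by blast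
  have \<sigma>ne: "\<sigma> 1 \<noteq> \<sigma> 2" "\<sigma> 1 \<noteq> \<sigma> 3" "\<sigma> 3 \<noteq> \<sigma> 2"
    using permutes_inj[OF \<sigma>] by (auto simp: inj_eq)
  have "a * d - b * c = hdet l (\<sigma> 3) (\<sigma> 2) * hdet l (\<sigma> 1) (\<sigma> 3) * hdet l (\<sigma> 1) (\<sigma> 2)"
    by (simp add: a_def b_def c_def d_def hdet_def algebra_simps)
  then have det: "a * d - b * c \<noteq> 0"
    using hdet_nonzero[OF l \<sigma>I[OF I(3)] \<sigma>I[OF I(2)] \<sigma>ne(3)]
      hdet_nonzero[OF l \<sigma>I[OF I(1)] \<sigma>I[OF I(3)] \<sigma>ne(2)]
      hdet_nonzero[OF l \<sigma>I[OF I(1)] \<sigma>I[OF I(2)] \<sigma>ne(1)] by simp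
  \<comment> \<open>the only candidate, being determined by its values at the first three marked points\<close>
  define M0 where "M0 = sphere_moebius a b c d"
  have M0: "M0 \<in> Moeb" unfolding M0_def by (rule MoebI[OF det])
  have td: "transfer_defect \<sigma> l i = (a * hx l i + b * hy l i) * hy l (\<sigma> i) -
      hx l (\<sigma> i) * (c * hx l i + d * hy l i)" for i
    unfolding transfer_defect_def a_def b_def c_def d_def ..
  have iff: "M0 (marked_points l i) = marked_points l (\<sigma> i) \<longleftrightarrow> transfer_defect \<sigma> l i = 0" for i
    unfolding M0_def marked_points_hpoint sphere_moebius_hpoint[OF det hcoords_nonzero]
      hpoint_eq_iff[OF regular_matrix_kernel[OF det hcoords_nonzero] hcoords_nonzero] td
    by simp
  have h123: "hx l (Suc 0) = 1" "hy l (Suc 0) = 0" "hx l 2 = 0" "hy l 2 = 1" "hx l 3 = 1" "hy l 3 = 1"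
    by (simp_all add: hx_def hy_def)
  have "transfer_defect \<sigma> l 1 = 0" "transfer_defect \<sigma> l 2 = 0" "transfer_defect \<sigma> l 3 = 0"
    unfolding transfer_defect_def hdet_def by (simp_all add: h123 algebra_simps)
  then have base: "M0 (marked_points l i) = marked_points l (\<sigma> i)" if "i = 1 \<or> i = 2 \<or> i = 3" for i
    using iff that by blast
  have uniq: "M = M0" if M: "M \<in> Moeb" "\<forall>i\<in>?I. M (marked_points l i) = marked_points l (\<sigma> i)" for M
  proof (rule Moeb_eqI[OF M(1) M0])
    show "marked_points l 1 \<noteq> marked_points l 2" "marked_points l 1 \<noteq> marked_points l 3"
      "marked_points l 2 \<noteq> marked_points l 3" by simp_all
    have agree: "M (marked_points l i) = M0 (marked_points l i)" if "i \<in> ?I" "i = 1 \<or> i = 2 \<or> i = 3" for i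
      unfolding base[OF that(2)] by (rule bspec[OF M(2) that(1)])
    show "M (marked_points l 1) = M0 (marked_points l 1)"
      "M (marked_points l 2) = M0 (marked_points l 2)" "M (marked_points l 3) = M0 (marked_points l 3)"
      by (rule agree[OF I(1)], simp, rule agree[OF I(2)], simp, rule agree[OF I(3)], simp)
  qed
  show ?thesis
  proof
    assume "\<exists>M\<in>Moeb. \<forall>i\<in>?I. M (marked_points l i) = marked_points l (\<sigma> i)"
    then obtain M where M: "M \<in> Moeb" "\<forall>i\<in>?I. M (marked_points l i) = marked_points l (\<sigma> i)"
      by (rule bexE)
    have "M = M0" by (rule uniq[OF M])
    show "\<forall>i\<in>?I. transfer_defect \<sigma> l i = 0"
    proof
      fix i assume "i \<in> ?I"
      then have "M0 (marked_points l i) = marked_points l (\<sigma> i)"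
        using M(2) unfolding \<open>M = M0\<close> by blast
      then show "transfer_defect \<sigma> l i = 0" by (rule iff[THEN iffD1])
    qed
  next
    assume "\<forall>i\<in>?I. transfer_defect \<sigma> l i = 0"
    then have "\<forall>i\<in>?I. M0 (marked_points l i) = marked_points l (\<sigma> i)"
      by (intro ballI iff[THEN iffD2]) (rule bspec)
    then show "\<exists>M\<in>Moeb. \<forall>i\<in>?I. M (marked_points l i) = marked_points l (\<sigma> i)"
      by (rule bexI[OF _ M0])
  qed
qed

lemma continuous_map_transfer_defect:
  assumes n: "n \<ge> 2" and \<sigma>: "\<sigma> permutes {1..n + 1}" and i: "i \<in> {1..n + 1}"
  shows "continuous_map (Omega_topology n) euclidean (\<lambda>l. transfer_defect \<sigma> l i)"
proof -
  have cx: "continuous_map (Omega_topology n) euclidean (\<lambda>l. hx l j)" if "j \<in> {1..n + 1}" for j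
  proof (cases "j \<le> 3")
    case True
    then have "j = 1 \<or> j = 2 \<or> j = 3" using that by auto
    then show ?thesis by (auto simp: hx_def)
  next
    case False
    then have "j - 3 \<in> {1..n - 2}" using that by auto
    then have "continuous_map (Omega_topology n) euclidean (\<lambda>l. l (j - 3))"
      unfolding Omega_topology_def
      using continuous_map_from_subtopology[OF continuous_map_product_projection] by metis
    then show ?thesis using False by (simp add: hx_def)
  qed
  have cy: "continuous_map (Omega_topology n) euclidean (\<lambda>l. hy l j)" for j
    by (simp add: hy_def)
  have \<sigma>I: "\<sigma> j \<in> {1..n + 1}" if "j \<in> {1..n + 1}" for j using permutes_in_image[OF \<sigma>] that by blast
  have I: "1 \<in> {1..n + 1}" "2 \<in> {1..n + 1}" "3 \<in> {1..n + 1}" using n by auto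
  show ?thesis unfolding transfer_defect_def hdet_def
    by (intro continuous_map_cmult continuous_map_cadd continuous_map_cdiff cx cy \<sigma>I I i)
qed

lemma closedin_transferred:
  assumes n: "n \<ge> 2" and \<sigma>: "\<sigma> permutes {1..n + 1}"
  shows "closedin (Omega_topology n)
    {l \<in> Omega n. \<exists>M\<in>Moeb. \<forall>i\<in>{1..n + 1}. M (marked_points l i) = marked_points l (\<sigma> i)}"
proof -
  have "closedin (Omega_topology n)
      (\<Inter>i\<in>{1..n + 1}. {l \<in> topspace (Omega_topology n). transfer_defect \<sigma> l i \<in> {0}})"
    by (intro closedin_INT closedin_continuous_map_preimage[OF continuous_map_transfer_defect[OF n \<sigma>]])
      auto
  also have "(\<Inter>i\<in>{1..n + 1}. {l \<in> topspace (Omega_topology n). transfer_defect \<sigma> l i \<in> {0}}) =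
      {l \<in> Omega n. \<exists>M\<in>Moeb. \<forall>i\<in>{1..n + 1}. M (marked_points l i) = marked_points l (\<sigma> i)}"
    using transfer_iff_defect_zero[OF n _ \<sigma>] by (auto simp: topspace_Omega_topology)
  finally show ?thesis .
qed

text \<open>The number of fixed points of a symmetry among the marked points is that of the permutation of the
  labels which it induces.  So a stratum is a finite union of sets belonging to single permutations.\<close>

lemma symmetric_stratum_preimage:
  assumes n: "n \<ge> 2"
  shows "{l \<in> Omega n. moduli_class n l \<in> symmetric_stratum n r} =
    (\<Union>\<sigma>\<in>{\<sigma>. \<sigma> permutes {1..n + 1} \<and> \<sigma> \<noteq> id \<and> card {i \<in> {1..n + 1}. \<sigma> i = i} = r}.
      {l \<in> Omega n. \<exists>M\<in>Moeb. \<forall>i\<in>{1..n + 1}. M (marked_points l i) = marked_points l (\<sigma> i)})"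
    (is "?A = ?B")
proof -
  let ?I = "{1..n + 1}"
  have fixcard: "card {x \<in> marked_set n l. M x = x} = card {i \<in> ?I. \<sigma> i = i}"
    if l: "l \<in> Omega n" and \<sigma>: "\<sigma> permutes ?I"
      and M: "\<And>i. i \<in> ?I \<Longrightarrow> M (marked_points l i) = marked_points l (\<sigma> i)" for l \<sigma> M
  proof -
    note inj = inj_on_marked_points[OF l]
    have "M (marked_points l i) = marked_points l i \<longleftrightarrow> \<sigma> i = i" if "i \<in> ?I" for i
    proof -
      have "\<sigma> i \<in> ?I" using permutes_in_image[OF \<sigma>, of i] that by simp
      then show ?thesis unfolding M[OF that] by (rule inj_on_eq_iff[OF inj _ that])
    qed
    then have "{x \<in> marked_set n l. M x = x} = marked_points l ` {i \<in> ?I. \<sigma> i = i}"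
      unfolding marked_set_def by blast
    then show ?thesis by (simp only:) (rule card_image[OF inj_on_subset[OF inj]], blast)
  qed
  show ?thesis
  proof (intro equalityI subsetI)
    fix l assume "l \<in> ?A"
    then have l: "l \<in> Omega n" "moduli_class n l \<in> symmetric_stratum n r" by auto
    then obtain M where M: "M \<in> Moeb" "M \<noteq> id" "M ` marked_set n l = marked_set n l"
      "card {x \<in> marked_set n l. M x = x} = r"
      using mem_symmetric_stratum_iff[OF n l(1)] by blast
    obtain \<tau> where \<tau>: "\<tau> permutes ?I"
      "\<And>i. i \<in> ?I \<Longrightarrow> M (marked_points l (\<tau> i)) = marked_points l i"
      using Moeb_induces_permutation[OF l(1) l(1) M(1,3)] by blast
    define \<sigma> where "\<sigma> = inv_into UNIV \<tau>"
    have \<sigma>: "\<sigma> permutes ?I" unfolding \<sigma>_def by (rule permutes_inv[OF \<tau>(1)])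
    have M\<sigma>: "M (marked_points l i) = marked_points l (\<sigma> i)" if "i \<in> ?I" for i
    proof -
      have "\<sigma> i \<in> ?I" using permutes_in_image[OF \<sigma>, of i] that by simp
      from \<tau>(2)[OF this] show ?thesis using permutes_inverses(1)[OF \<tau>(1)] by (simp add: \<sigma>_def)
    qed
    have "\<sigma> \<noteq> id"
    proof
      assume "\<sigma> = id"
      then have "M x = id x" if "x \<in> marked_set n l" for x using that M\<sigma> by (auto simp: marked_set_def)
      then have "M = id"
        using card_marked_set[OF l(1)] n by (intro Moeb_eqI_on[OF M(1) Moeb_id, of "marked_set n l"]) auto
      then show False using M(2) by simp
    qed
    moreover have "card {i \<in> ?I. \<sigma> i = i} = r" using fixcard[OF l(1) \<sigma> M\<sigma>] M(4) by simp
    ultimately show "l \<in> ?B" using \<sigma> l(1) M(1) M\<sigma> by blast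
  next
    fix l assume "l \<in> ?B"
    then obtain \<sigma> M where \<sigma>: "\<sigma> permutes ?I" "\<sigma> \<noteq> id" "card {i \<in> ?I. \<sigma> i = i} = r"
      and l: "l \<in> Omega n" and M: "M \<in> Moeb" "\<forall>i\<in>?I. M (marked_points l i) = marked_points l (\<sigma> i)"
      by blast
    have "M ` marked_set n l = marked_points l ` \<sigma> ` ?I"
      unfolding marked_set_def image_image using M(2) by (intro image_cong) auto
    then have MS: "M ` marked_set n l = marked_set n l"
      unfolding permutes_image[OF \<sigma>(1)] marked_set_def .
    have "M \<noteq> id"
    proof
      assume "M = id"
      have "\<sigma> i = i" for i
      proof (cases "i \<in> ?I")
        case True
        then have "marked_points l (\<sigma> i) = marked_points l i" using M(2) \<open>M = id\<close> by simp
        then show ?thesis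
          using inj_onD[OF inj_on_marked_points[OF l]] True permutes_in_image[OF \<sigma>(1)] by blast
      qed (rule permutes_not_in[OF \<sigma>(1)])
      then show False using \<sigma>(2) by (simp add: fun_eq_iff)
    qed
    moreover have "card {x \<in> marked_set n l. M x = x} = r" using fixcard[OF l \<sigma>(1)] M(2) \<sigma>(3) by simp
    ultimately show "l \<in> ?A" using mem_symmetric_stratum_iff[OF n l] l M(1) MS by blast
  qed
qed

lemma closedin_symmetric_stratum:
  assumes n: "n \<ge> 2"
  shows "closedin (moduli_space n) (symmetric_stratum n r)"
proof -
  let ?P = "{\<sigma>. \<sigma> permutes {1..n + 1} \<and> \<sigma> \<noteq> id \<and> card {i \<in> {1..n + 1}. \<sigma> i = i} = r}"
  have "finite ?P"
    by (rule finite_subset[OF _ finite_permutations[of "{1..n + 1}"]]) auto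
  moreover have "closedin (Omega_topology n)
      {l \<in> Omega n. \<exists>M\<in>Moeb. \<forall>i\<in>{1..n + 1}. M (marked_points l i) = marked_points l (\<sigma> i)}"
    if "\<sigma> \<in> ?P" for \<sigma> using that closedin_transferred[OF n] by blast
  ultimately have "closedin (Omega_topology n) {l \<in> Omega n. moduli_class n l \<in> symmetric_stratum n r}"
    unfolding symmetric_stratum_preimage[OF n] by (intro closedin_Union finite_imageI) blast+
  moreover have "quotient_map (Omega_topology n) (moduli_space n) (moduli_class n)"
    unfolding moduli_space_def by (rule quotient_map_quotient_topology)
  moreover have "symmetric_stratum n r \<subseteq> topspace (moduli_space n)"
    using symmetric_stratum_subset_moduli[OF n]
    by (simp add: moduli_space_def topspace_quotient_topology topspace_Omega_topology)
  ultimately show ?thesis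
    unfolding quotient_map_closedin topspace_Omega_topology by blast
qed

section \<open>Connected components of the branch locus\<close>

text \<open>Each piece is the complement of the other, hence open as well as closed.\<close>

lemma connected_components_of_two_closed_pieces:
  assumes top: "topspace X = U \<union> V" and disj: "U \<inter> V = {}" and ne: "U \<noteq> {}" "V \<noteq> {}"
    and cl: "closedin X U" "closedin X V" and conn: "connectedin X U" "connectedin X V"
  shows "connected_components_of X = {U, V}"
proof -
  have piece: "connected_component_of_set X x = A"
    if "topspace X = A \<union> B" "A \<inter> B = {}" "closedin X A" "closedin X B" "connectedin X A" "x \<in> A"
    for A B x
  proof (rule connected_component_of_unique)
    fix C assume C: "x \<in> C \<and> connectedin X C"
    have "A = topspace X - B" using that(1,2) by blast
    then have "openin X A" using that(4) by blast
    then have "C \<subseteq> A \<or> disjnt C A" using connectedin_clopen_cases[of X C A] C that(3) by blast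
    then show "C \<subseteq> A" using C that(6) by (auto simp: disjnt_def)
  qed (use that in auto)
  have "connected_component_of_set X ` U = {U}"
    using piece[OF top disj cl conn(1)] ne(1) by auto
  moreover have "connected_component_of_set X ` V = {V}"
    using piece[of V U] top disj cl conn(2) ne(2) by (auto simp: Un_commute Int_commute)
  ultimately show ?thesis unfolding connected_components_of_def top by (simp add: image_Un insert_commute)
qed

theorem theorem1:
  fixes n :: nat
  assumes "n \<ge> 4"
  shows "((even n \<or> (n \<ge> 6 \<and> 3 dvd n)) \<longrightarrow>
            connectedin (moduli_space n) (branch_locus n)) \<and>
         (\<not> (even n \<or> (n \<ge> 6 \<and> 3 dvd n)) \<longrightarrow>
            card (connected_components_of (subtopology (moduli_space n) (branch_locus n))) = 2)"
proof -
  have n2: "n \<ge> 2" and n3: "n \<ge> 3" using assms by simp_all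
  let ?X = "moduli_space n"
  let ?U = "symmetric_stratum n 1" and ?V = "symmetric_stratum n 0 \<union> symmetric_stratum n 2"
  have branch: "branch_locus n = ?U \<union> ?V"
    unfolding branch_locus_eq[OF assms] by (auto simp: atMost_nat_numeral atMost_Suc)
  have U: "connectedin ?X ?U" by (rule connectedin_symmetric_stratum[OF n3]) simp
  have V: "connectedin ?X ?V" if "odd n" by (rule connectedin_strata_0_2_odd[OF n3 that])
  show ?thesis
  proof (intro conjI impI)
    assume h: "even n \<or> (n \<ge> 6 \<and> 3 dvd n)"
    show "connectedin ?X (branch_locus n)"
    proof (cases "even n")
      case True
      then show ?thesis by (rule connectedin_branch_locus_even[OF assms])
    next
      case False
      then have "?U \<inter> ?V \<noteq> {}" using h by (intro strata_meet) auto
      then show ?thesis unfolding branch by (rule connectedin_Un[OF U V[OF False]])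
    qed
  next
    assume h: "\<not> (even n \<or> (n \<ge> 6 \<and> 3 dvd n))"
    then have odd: "odd n" by simp
    \<comment> \<open>from \<open>4\<close> on, the odd multiples of \<open>3\<close> are at least \<open>9\<close>\<close>
    have three: "\<not> 3 dvd n" using h assms by presburger
    let ?Y = "subtopology ?X (branch_locus n)"
    have disj: "?U \<inter> ?V = {}"
      using strata_disjoint[OF assms odd three, of 0] strata_disjoint[OF assms odd three, of 2] by auto
    have ne: "?U \<noteq> {}" "?V \<noteq> {}"
      using polygon_class_in_stratum[OF n3, of 1] polygon_class_in_stratum[OF n3, of 0] by auto
    have sub: "?U \<union> ?V \<subseteq> topspace ?X"
      using connectedin_subset_topspace[OF U] connectedin_subset_topspace[OF V[OF odd]] by blast
    have "connected_components_of ?Y = {?U, ?V}"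
    proof (rule connected_components_of_two_closed_pieces)
      show "topspace ?Y = ?U \<union> ?V" using sub by (simp add: branch Int_absorb1)
      have "closedin ?X ?U" "closedin ?X ?V"
        by (intro closedin_Un closedin_symmetric_stratum[OF n2])+
      then show "closedin ?Y ?U" "closedin ?Y ?V"
        unfolding branch by (auto intro: closedin_subset_topspace)
      show "connectedin ?Y ?U" "connectedin ?Y ?V"
        using U V[OF odd] unfolding branch connectedin_subtopology by auto
    qed (use disj ne in auto)
    moreover have "?U \<noteq> ?V" using disj ne by blast
    ultimately show "card (connected_components_of ?Y) = 2" by simp
  qed
qed

end
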